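(* For every integer $k\ge2$, \[ \sum_{m_1,\dots,m_k\in\mathbb{Z}}\sum_{r,s,n\ge0}\mathcal{D}^o_k(r,s,m_1,\dots,m_k,n)x_1^{m_1}\cdots x_k^{m_k}a^rb^sq^n =\frac{(-aq,-bq;q^2)_\infty}{(q^2,abq^2;q^2)_\infty}\sum_{n\ge0}\frac{(1-q^{4n+2})(-q/a,-q/b;q^2)_n(-ab)^nq^{n^2+(2k+1)n+k}}{(-aq,-bq;q^2)_{n+1}\prod_{i=1}^k(1-x_iq^{2n+1})(1-q^{2n+1}/x_i)}. \]
   Context: For $|q|<1$, $c\in\mathbb{C}$ and $n\in\mathbb{Z}_{\ge0}\cup\{\infty\}$ write $(c;q)_n=\prod_{\ell=0}^{n-1}(1-cq^\ell)$ and $(c_1,\dots,c_j;q)_n=(c_1;q)_n\cdots(c_j;q)_n$. A generalized odd Durfee symbol for a positive integer $n$ is a two-rowed array $\begin{pmatrix}a_1&\cdots&a_i\\ b_1&\cdots&b_j\end{pmatrix}_{\lambda,\mu,t}$ where $t\ge0$ is an integer, $\lambda,\mu$ are partitions into distinct odd parts of size at most $2t-1$, each row is a (possibly empty) partition into odd parts of size at most $2t+1$, and $n=\sum a_\ell+\sum b_\ell+|\lambda|+|\mu|+2t+1$. An odd number $2x-1$ is missing from such $\nu$ if $1\le x\le t$ and $2x-1$ is not a part of $\nu$. A $k$-marked generalized odd Durfee symbol for $n$ is a generalized odd Durfee symbol for $n$ whose entries additionally each carry a subscript (color) in $\{1,\dots,k\}$ such that: (1) in each row the sequence of parts and the sequence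 of subscripts are non-increasing; (2) each of the subscripts $1,\dots,k-1$ occurs at least once in the top row; (3) if $M_1,\dots,M_{k-1}$ are the largest top-row parts with subscripts $1,\dots,k-1$ respectively, then every bottom-row part with subscript $1$ lies in $[1,M_1]$, with subscript $i$ ($2\le i\le k-1$) lies in $[M_{i-1},M_i]$, and with subscript $k$ lies in $[M_{k-1},t]$, where $t$ is the third subscript of the symbol. For such a symbol $\delta$ let $\tau_i(\delta)$ (resp. $\beta_i(\delta)$) be the number of top-row (resp. bottom-row) entries with subscript $i$, and define the $i$th rank $\rho_i(\delta)=\tau_i(\delta)-\beta_i(\delta)-1$ for $1\le i<k$ and $\rho_k(\delta)=\tau_k(\delta)-\beta_k(\delta)$. Let $\mathcal{D}^o_k(r,s,m_1,\dots,m_k,n)$ be the number of $k$-marked generalized odd Durfee symbols for $n$ with $r$ missing numbers in $\lambda$, $s$ missing numbers in $\mu$, and $i$th rank $m_i$ for each $i$.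
   Formalization: In condition (3), bottom-row parts with subscript k range over [M_{k-1}, 2t+1] instead of [M_{k-1}, t] (false for k=2, n=3); the identity is stated analytically for a,b,x_i≠0, |x_i q|,|q/x_i|,|abq^2|<1 and nonvanishing (-aq,-bq;q^2)_n. *)

theory Defs
  imports "HOL-Analysis.Analysis" "HOL-Library.Extended_Nat"
begin

definition qpoch1 :: "complex \<Rightarrow> complex \<Rightarrow> enat \<Rightarrow> complex" where
  "qpoch1 c q n = (case n of
       enat N \<Rightarrow> (\<Prod>l<N. 1 - c * q ^ l)
     | \<infinity> \<Rightarrow> prodinf (\<lambda>l. 1 - c * q ^ l))"

definition qpoch :: "complex list \<Rightarrow> complex \<Rightarrow> enat \<Rightarrow> complex" where
  "qpoch cs q n = (\<Prod>c\<leftarrow>cs. qpoch1 c q n)"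

text \<open>
  Partitions are non-increasing lists of positive integers. The entries of the two rows have
  type \<open>nat\<close> for plain symbols and type \<open>nat \<times> nat\<close>, a part paired with its
  subscript, for marked symbols.
\<close>

datatype 'e durfee_array =
  Durfee_Array (top_row: "'e list") (bottom_row: "'e list")
    (lam: "nat list") (mu: "nat list") (side: nat)

definition odd_partition :: "nat \<Rightarrow> nat list \<Rightarrow> bool" where
  "odd_partition B ps \<longleftrightarrow> sorted_wrt (\<ge>) ps \<and> (\<forall>p\<in>set ps. odd p \<and> p \<le> B)"

text \<open>For \<open>t = 0\<close> the truncated bound \<open>2 * t - 1\<close> is \<open>0\<close>, which still leaves only the empty partition.\<close>

definition gen_odd_durfee_symbol :: "nat durfee_array \<Rightarrow> nat \<Rightarrow> bool" where
  "gen_odd_durfee_symbol d n \<longleftrightarrow>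
     n > 0 \<and>
     odd_partition (2 * side d - 1) (lam d) \<and> distinct (lam d) \<and>
     odd_partition (2 * side d - 1) (mu d) \<and> distinct (mu d) \<and>
     odd_partition (2 * side d + 1) (top_row d) \<and>
     odd_partition (2 * side d + 1) (bottom_row d) \<and>
     n = sum_list (top_row d) + sum_list (bottom_row d)
           + sum_list (lam d) + sum_list (mu d) + 2 * side d + 1"

definition missing :: "nat \<Rightarrow> nat list \<Rightarrow> nat set" where
  "missing t ps = {2 * x - 1 | x. 1 \<le> x \<and> x \<le> t \<and> 2 * x - 1 \<notin> set ps}"

text \<open>Only meaningful if the subscript \<open>i\<close> occurs in the top row.\<close>

definition largest_top :: "(nat \<times> nat) durfee_array \<Rightarrow> nat \<Rightarrow> nat" where
  "largest_top d i = Max {p. (p, i) \<in> set (top_row d)}"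

text \<open>
  The bottom row parts with subscript \<open>k\<close> range up to \<open>2 * side d + 1\<close>, the bound on
  all entries of the rows. With \<open>side d\<close> itself as upper end the generating function
  would not be invariant under \<open>x\<^sub>k \<mapsto> 1 / x\<^sub>k\<close>.
\<close>

definition marked_gen_odd_durfee_symbol :: "nat \<Rightarrow> (nat \<times> nat) durfee_array \<Rightarrow> nat \<Rightarrow> bool" where
  "marked_gen_odd_durfee_symbol k d n \<longleftrightarrow>
     gen_odd_durfee_symbol (map_durfee_array fst d) n \<and>
     (\<forall>(p, c) \<in> set (top_row d) \<union> set (bottom_row d). c \<in> {1..k}) \<and>
     sorted_wrt (\<ge>) (map snd (top_row d)) \<and> sorted_wrt (\<ge>) (map snd (bottom_row d)) \<and>
     (\<forall>i\<in>{1..k - 1}. \<exists>p. (p, i) \<in> set (top_row d)) \<and>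
     (\<forall>(p, c) \<in> set (bottom_row d).
        (c = 1 \<longrightarrow> p \<in> {1..largest_top d 1}) \<and>
        (2 \<le> c \<and> c \<le> k - 1 \<longrightarrow> p \<in> {largest_top d (c - 1)..largest_top d c}) \<and>
        (c = k \<longrightarrow> p \<in> {largest_top d (k - 1)..2 * side d + 1}))"

definition marks :: "(nat \<times> nat) list \<Rightarrow> nat \<Rightarrow> nat" where
  "marks es i = length (filter (\<lambda>e. snd e = i) es)"

definition rank_at :: "nat \<Rightarrow> (nat \<times> nat) durfee_array \<Rightarrow> nat \<Rightarrow> int" where
  "rank_at k d i =
     int (marks (top_row d) i) - int (marks (bottom_row d) i) - (if i < k then 1 else 0)"

definition num_symbols :: "nat \<Rightarrow> nat \<Rightarrow> nat \<Rightarrow> (nat \<Rightarrow> int) \<Rightarrow> nat \<Rightarrow> nat" where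
  "num_symbols k r s m n =
     card {d. marked_gen_odd_durfee_symbol k d n \<and>
              card (missing (side d) (lam d)) = r \<and>
              card (missing (side d) (mu d)) = s \<and>
              (\<forall>i\<in>{1..k}. rank_at k d i = m i)}"

end

theory Submission
  imports Defs
begin

text \<open>
  For fixed \<open>t\<close>, removing the parts of the largest color from both rows and one largest part of the next
  color from the top row gives a recursion in \<open>k\<close> for the generating function of the rows. This recursion
  turns a Bailey pair \<open>(\<alpha>\<^sub>n, \<beta>\<^sub>t)\<close> into one whose \<open>\<alpha>\<^sub>n\<close> is multiplied by
  \<open>q ^ (2 * n + 1) / ((1 - x * q ^ (2 * n + 1)) * (1 - q ^ (2 * n + 1) / x))\<close>. Hence, starting from the
  unit Bailey pair, the generating function of the rows is an explicit Bailey sum over \<open>n \<le> t\<close>. Multiplying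
  it by the generating function of \<open>\<lambda>\<close> and \<open>\<mu>\<close>, summing over \<open>t\<close> first and evaluating the inner sum by
  the q-Gauss summation is Bailey's lemma and gives the right-hand side.
\<close>

section \<open>Bailey pairs and the generating function of the rows\<close>

text \<open>The pivot is an identity in which each rank variable separates. For
  \<open>w = q ^ (2 * (t - n))\<close> and \<open>Q = q ^ (2 * n + 1)\<close>, the difference (1 - x
  w Q)(1 - w Q / x) - (1 - w)(1 - w Q^2) equals w (1 - x Q)(1 - Q / x). The first product is the
  rank factor at \<open>t\<close>, the second is the quotient of the Bailey kernels at
  \<open>t - 1\<close> and \<open>t\<close>, and on the right \<open>x\<close> occurs only in the
  rank factor at \<open>n\<close>. Hence a new color changes \<alpha> by a factor that does not
  involve the earlier variables, and the numerator \<open>q ^ (2 * n + 1)\<close> is what remains of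
  the part \<open>2 * M + 1\<close> that the new color forces into the top row. The other difficulty
  is analytic. The identity is read for complex values, so the exchange of the sums over
  \<open>n\<close> and \<open>t\<close> and the regrouping of symbols by their exponents both need
  absolute convergence. The exchange rests on a uniform bound for the kernel. The regrouping rests
  on evaluating the same generating function at the absolute values of all variables.\<close>

definition qfac :: "complex \<Rightarrow> complex \<Rightarrow> nat \<Rightarrow> complex" where
  "qfac c p n = (\<Prod>l<n. 1 - c * p ^ l)"

lemma qfac_0 [simp]: "qfac c p 0 = 1"
  by (simp add: qfac_def)

lemma qfac_Suc: "qfac c p (Suc n) = qfac c p n * (1 - c * p ^ n)"
  by (simp add: qfac_def)

lemma qfac_add: "qfac c p (m + n) = qfac c p m * qfac (c * p ^ m) p n"
  by (induction n) (simp_all add: qfac_Suc power_add mult.assoc)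

lemma one_minus_neq_0:
  fixes z :: complex
  assumes "norm z < 1"
  shows "1 - z \<noteq> 0"
  using assms by auto

lemma norm_power_mult_less_1:
  fixes c p :: complex
  assumes "norm c < 1" "norm p \<le> 1"
  shows "norm (c * p ^ n) < 1"
proof -
  have "norm (c * p ^ n) \<le> norm c"
    using assms by (simp add: norm_mult norm_power mult_left_le power_le_one)
  then show ?thesis
    using assms by simp
qed

lemma qfac_neq_0:
  assumes "norm c < 1" "norm p \<le> 1"
  shows "qfac c p n \<noteq> 0"
  unfolding qfac_def using one_minus_neq_0[OF norm_power_mult_less_1[OF assms]] by (subst prod_zero_iff) auto

text \<open>
  Up to the factor \<open>1 - q\<^sup>2\<close>, a Bailey pair relative to \<open>q\<^sup>2\<close> in base \<open>p = q\<^sup>2\<close> is a pair of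
  sequences with \<open>\<beta>\<^sub>t = (\<Sum>n\<le>t. \<alpha>\<^sub>n * bailey_kernel p t n)\<close>.
\<close>

definition bailey_kernel :: "complex \<Rightarrow> nat \<Rightarrow> nat \<Rightarrow> complex" where
  "bailey_kernel p t n = (if n \<le> t then 1 / (qfac p p (t - n) * qfac p p (t + n + 1)) else 0)"

definition rank_factor :: "complex \<Rightarrow> complex \<Rightarrow> nat \<Rightarrow> complex" where
  "rank_factor q x t = (1 - x * q ^ (2 * t + 1)) * (1 - q ^ (2 * t + 1) / x)"

text \<open>The kernels at \<open>t\<close> and \<open>t + 1\<close> differ by the factors
  \<open>1 - p ^ (t + 1 - n)\<close> and \<open>1 - p ^ (t + n + 2)\<close>. Subtracting their
  product from the rank factor at \<open>t + 1\<close> leaves a multiple of the rank factor at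
  \<open>n\<close>.\<close>

lemma bailey_kernel_step:
  assumes q: "norm q < 1" and x: "x \<noteq> 0" and n: "n \<le> Suc t"
  shows "rank_factor q x (Suc t) * bailey_kernel (q\<^sup>2) (Suc t) n - bailey_kernel (q\<^sup>2) t n
       = q ^ (2 * (Suc t - n)) * rank_factor q x n * bailey_kernel (q\<^sup>2) (Suc t) n"
proof -
  define p where "p = q\<^sup>2"
  have p: "norm p < 1"
    using q by (simp add: p_def norm_power power_less_one_iff)
  have nz: "qfac p p m \<noteq> 0" for m
    using qfac_neq_0 p by simp
  \<comment> \<open>For \<open>n = t + 1\<close> both sides vanish, the right one through
    \<open>1 - p ^ 0\<close>, so the boundary term obeys the same relation.\<close>
  have prev: "bailey_kernel p t n
      = bailey_kernel p (Suc t) n * (1 - p ^ (Suc t - n)) * (1 - p ^ (Suc t + n + 1))"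
  proof (cases "n \<le> t")
    case True
    then have "Suc t - n = Suc (t - n)" by simp
    moreover have "1 - p * p ^ (t - n) \<noteq> 0" "1 - p * p ^ (t + n + 1) \<noteq> 0"
      by (intro one_minus_neq_0 norm_power_mult_less_1; use p in simp)+
    ultimately show ?thesis
      using True nz by (simp add: bailey_kernel_def qfac_Suc)
  next
    case False
    with n have "n = Suc t" by simp
    then show ?thesis
      by (simp add: bailey_kernel_def)
  qed
  define m where "m = Suc t - n"
  define Q where "Q = q ^ (2 * n + 1)"
  have Suct: "Suc t = n + m"
    using n by (simp add: m_def)
  have e1: "q ^ (2 * Suc t + 1) = q ^ (2 * m) * Q"
    unfolding Q_def Suct by (simp add: power_add power_mult)
  have e2: "p ^ (Suc t + n + 1) = q ^ (2 * m) * Q\<^sup>2"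
    unfolding Q_def Suct p_def by (simp add: power_add power_mult power_mult_distrib) (simp add: power2_eq_square)
  have e3: "p ^ m = q ^ (2 * m)"
    by (simp add: p_def power_mult)
  have *: "rank_factor q x (Suc t) - (1 - p ^ m) * (1 - p ^ (Suc t + n + 1))
      = q ^ (2 * m) * rank_factor q x n"
    unfolding rank_factor_def e1 e2 e3 Q_def[symmetric]
    using x by (simp add: field_simps power2_eq_square)
  show ?thesis
    unfolding p_def[symmetric] prev m_def[symmetric] *[symmetric]
    by algebra
qed

text \<open>The coefficients are those of the unit Bailey pair. Their partial sums have a closed
  form, which reduces the evaluation to an induction on \<open>N\<close>; \<open>N < t\<close> keeps
  \<open>t - N - 1\<close> from being truncated.\<close>

lemma unit_bailey_partial_sum:
  assumes q: "norm q < 1" and "N < t"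
  shows "(\<Sum>n\<le>N. (1 - q ^ (4 * n + 2)) * (- 1) ^ n * q ^ (n * (n - 1)) * bailey_kernel (q\<^sup>2) t n)
    = (- 1) ^ N * q ^ (N * (N + 1)) * (1 - q ^ (2 * N + 2))
        / ((1 - q ^ (2 * t)) * qfac (q\<^sup>2) (q\<^sup>2) (t - N - 1) * qfac (q\<^sup>2) (q\<^sup>2) (t + N + 1))"
proof -
  define p where "p = q\<^sup>2"
  have p: "norm p < 1"
    using q by (simp add: p_def norm_power power_less_one_iff)
  have nz: "qfac p p m \<noteq> 0" for m
    using qfac_neq_0 p by simp
  have nz': "1 - p ^ m \<noteq> 0" if "m > 0" for m
    using norm_power_mult_less_1[of p p "m - 1"] p that
    by (intro one_minus_neq_0) (cases m, simp_all)
  have pow: "q ^ (2 * m) = p ^ m" for m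
    by (simp add: p_def power_mult)
  show ?thesis
    using \<open>N < t\<close>
  proof (induction N)
    case 0
    have "t - 0 = Suc (t - 1)" using 0 by simp
    then have "qfac p p (t - 0) = qfac p p (t - 1) * (1 - p ^ t)"
      by (metis 0 Suc_diff_1 qfac_Suc power_Suc diff_zero)
    then show ?case
      unfolding p_def[symmetric] pow using 0 nz nz'[of t]
      by (simp add: bailey_kernel_def mult.commute flip: p_def)
  next
    case (Suc N)
    \<comment> \<open>With \<open>A\<close>, \<open>B\<close> and \<open>s\<close> split off, all
      powers are expressed by \<open>X\<close>, \<open>P\<close> and \<open>p\<close>, since
      \<open>p ^ t = X * P\<close>. The induction step becomes a rational identity in these three
      quantities.\<close>
    define A B where "A = qfac p p (t - N - 2)" and "B = qfac p p (t + N + 1)"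
    define X P s where "X = p ^ Suc N" and "P = p ^ (t - Suc N)"
      and "s = (- 1) ^ N * q ^ (N * (N + 1)) "
    have pt: "p ^ t = X * P"
      using Suc.prems by (simp add: X_def P_def del: power_Suc flip: power_add)
    have f1: "qfac p p (t - N - 1) = A * (1 - P)"
    proof -
      have "t - N - 1 = Suc (t - N - 2)" "t - Suc N = Suc (t - N - 2)"
        using Suc.prems by simp_all
      then show ?thesis
        by (simp add: A_def P_def qfac_Suc)
    qed
    have f2: "qfac p p (t + N + 2) = B * (1 - X * P * X * p)"
    proof -
      have "qfac p p (t + N + 2) = B * (1 - p * p ^ (t + N + 1))"
        by (simp add: B_def qfac_Suc)
      also have "p * p ^ (t + N + 1) = p ^ t * X * p"
        by (simp add: X_def power_add)
      finally show ?thesis by (simp add: pt)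
    qed
    have nzs: "A \<noteq> 0" "B \<noteq> 0" "1 - P \<noteq> 0" "1 - X * P * X * p \<noteq> 0" "1 - X * P \<noteq> 0"
    proof -
      show "A \<noteq> 0" "B \<noteq> 0" using nz by (simp_all add: A_def B_def)
      show "1 - P \<noteq> 0" unfolding P_def using Suc.prems by (intro nz') simp
      show "1 - X * P \<noteq> 0" using nz'[of t] Suc.prems by (simp add: pt)
      have "p ^ (t + N + 2) = p ^ t * p ^ Suc N * p"
        by (simp add: power_add)
      then have "p ^ (t + N + 2) = X * P * X * p"
        unfolding pt X_def[symmetric] .
      moreover have "1 - p ^ (t + N + 2) \<noteq> 0" by (rule nz') simp
      ultimately show "1 - X * P * X * p \<noteq> 0" by (simp only:) simp
    qed
    have qX: "q ^ (2 * N + 2) = X"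
      using pow[of "Suc N"] by (simp add: X_def)
    have IH: "(\<Sum>n\<le>N. (1 - q ^ (4 * n + 2)) * (- 1) ^ n * q ^ (n * (n - 1)) * bailey_kernel p t n)
       = s * (1 - X) / ((1 - X * P) * (A * (1 - P)) * B)"
      using Suc.IH[OF Suc_lessD[OF Suc.prems]]
      unfolding p_def[symmetric] pow pt f1 qX s_def[symmetric] B_def[symmetric] .
    have summand: "(1 - q ^ (4 * Suc N + 2)) * (- 1) ^ Suc N * q ^ (Suc N * (Suc N - 1)) * bailey_kernel p t (Suc N)
       = (1 - X * X * p) * (- s) / (A * (1 - P) * (B * (1 - X * P * X * p)))"
    proof -
      have "4 * Suc N + 2 = 2 * (2 * Suc N + 1)"
        by simp
      then have "q ^ (4 * Suc N + 2) = p ^ (2 * Suc N + 1)"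
        by (simp only: pow)
      also have "\<dots> = X * X * p"
        unfolding X_def by (simp flip: power_add power_Suc2) (simp add: mult_2)
      finally have "q ^ (4 * Suc N + 2) = X * X * p" .
      moreover have "bailey_kernel p t (Suc N) = 1 / (A * (1 - P) * (B * (1 - X * P * X * p)))"
        using Suc.prems f1 f2 by (simp add: bailey_kernel_def)
      moreover have "q ^ (Suc N * (Suc N - 1)) = q ^ (N * (N + 1))"
        by (simp add: mult.commute)
      ultimately show ?thesis by (simp add: s_def)
    qed
    have rhs: "(- 1) ^ Suc N * q ^ (Suc N * (Suc N + 1)) * (1 - q ^ (2 * Suc N + 2))
        / ((1 - q ^ (2 * t)) * qfac p p (t - Suc N - 1) * qfac p p (t + Suc N + 1))
       = (- s) * X * (1 - X * p) / ((1 - X * P) * A * (B * (1 - X * P * X * p)))"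
    proof -
      have "q ^ (2 * Suc N + 2) = X * p"
        using pow[of "Suc (Suc N)"] by (simp add: X_def)
      moreover have "q ^ (Suc N * (Suc N + 1)) = q ^ (N * (N + 1)) * X"
      proof -
        have "Suc N * (Suc N + 1) = N * (N + 1) + 2 * Suc N" by simp
        then show ?thesis using pow[of "Suc N"] by (simp only: power_add X_def)
      qed
      ultimately show ?thesis
        using f2 unfolding pow pt by (simp add: A_def s_def)
    qed
    have "s * (1 - X) / ((1 - X * P) * (A * (1 - P)) * B)
        + (1 - X * X * p) * (- s) / (A * (1 - P) * (B * (1 - X * P * X * p)))
        = (- s) * X * (1 - X * p) / ((1 - X * P) * A * (B * (1 - X * P * X * p)))"
      using nzs by (simp add: divide_simps) algebra
    then show ?case
      unfolding sum.atMost_Suc p_def[symmetric] rhs IH summand .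
  qed
qed

text \<open>For \<open>t > 0\<close> the term \<open>n = t\<close> is the negative of the partial
  sum up to \<open>t - 1\<close>; for \<open>t = 0\<close> the only term is
  \<open>(1 - q^2) / (1 - q^2)\<close>.\<close>

lemma unit_bailey_sum:
  assumes q: "norm q < 1"
  shows "(\<Sum>n\<le>t. (1 - q ^ (4 * n + 2)) * (- 1) ^ n * q ^ (n * (n - 1)) * bailey_kernel (q\<^sup>2) t n)
    = (if t = 0 then 1 else 0)"
proof (cases t)
  case 0
  have "norm (q\<^sup>2) < 1"
    using q by (simp add: norm_power power_less_one_iff)
  then have "1 - q\<^sup>2 \<noteq> 0"
    by (rule one_minus_neq_0)
  then show ?thesis
    using 0 by (simp add: bailey_kernel_def qfac_Suc power2_eq_square)
next
  case (Suc N)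
  define p where "p = q\<^sup>2"
  have p: "norm p < 1"
    using q by (simp add: p_def norm_power power_less_one_iff)
  have nz: "qfac p p m \<noteq> 0" for m
    using qfac_neq_0 p by simp
  have nz': "1 - p * p ^ m \<noteq> 0" for m
    by (intro one_minus_neq_0 norm_power_mult_less_1) (use p in simp_all)
  have pow: "q ^ (2 * m) = p ^ m" for m
    by (simp add: p_def power_mult)
  have f: "qfac p p (Suc N + Suc N + 1) = qfac p p (2 * N + 2) * (1 - p * p ^ (2 * N + 2))"
    by (simp add: mult_2 qfac_Suc)
  have e: "q ^ (4 * Suc N + 2) = p * p ^ (2 * N + 2)"
  proof -
    have "4 * Suc N + 2 = 2 * Suc (2 * N + 2)" by simp
    then show ?thesis by (simp only: pow power_Suc)
  qed
  have "(\<Sum>n\<le>N. (1 - q ^ (4 * n + 2)) * (- 1) ^ n * q ^ (n * (n - 1)) * bailey_kernel p t n)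
    = (- 1) ^ N * q ^ (N * (N + 1)) / qfac p p (2 * N + 2)"
    using unit_bailey_partial_sum[OF q, of N "Suc N"] nz'[of N] pow[of "Suc N"]
    unfolding p_def[symmetric] Suc by (simp add: mult_2)
  moreover have "(1 - q ^ (4 * Suc N + 2)) * (- 1) ^ Suc N * q ^ (Suc N * (Suc N - 1)) * bailey_kernel p t (Suc N)
    = - ((- 1) ^ N * q ^ (N * (N + 1)) / qfac p p (2 * N + 2))"
    using f e nz'[of "2 * N + 2"] by (simp add: Suc bailey_kernel_def mult.commute[of "Suc N" N] mult_Suc[of N] del: mult_Suc)
  ultimately show ?thesis
    unfolding Suc sum.atMost_Suc p_def[symmetric] by simp
qed

text \<open>The generating function of the rows of a \<open>(j + 1)\<close>-marked symbol with entries at most \<open>2 * t + 1\<close>.\<close>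

primrec row_gf :: "complex \<Rightarrow> (nat \<Rightarrow> complex) \<Rightarrow> nat \<Rightarrow> nat \<Rightarrow> complex" where
  "row_gf q x 0 t = 1 / (\<Prod>l\<in>{0..t}. rank_factor q (x 1) l)"
| "row_gf q x (Suc j) t =
     (\<Sum>M\<le>t. q ^ (2 * M + 1) * row_gf q x j M / (\<Prod>l\<in>{M..t}. rank_factor q (x (j + 2)) l))"

text \<open>The exponent is \<open>n * (n - 1)\<close> from the unit Bailey pair, plus
  \<open>2 * n\<close> for color 1, plus \<open>2 * n + 1\<close> for each of the \<open>j\<close>
  further colors. Color 1 contributes one less because the recursion starts there and no
  distinguished part accompanies it.\<close>

definition row_coeff :: "complex \<Rightarrow> (nat \<Rightarrow> complex) \<Rightarrow> nat \<Rightarrow> nat \<Rightarrow> complex" where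
  "row_coeff q x j n = (1 - q ^ (4 * n + 2)) * (- 1) ^ n * q ^ (n\<^sup>2 + (2 * j + 1) * n + j)
      / (\<Prod>i = 1..j + 1. rank_factor q (x i) n)"

text \<open>The annulus \<open>|q| < |x| < 1 / |q|\<close>, stated without dividing by
  \<open>q\<close> so that \<open>q = 0\<close> is covered.\<close>

definition rank_domain :: "complex \<Rightarrow> complex \<Rightarrow> bool" where
  "rank_domain q x \<longleftrightarrow> norm q < 1 \<and> x \<noteq> 0 \<and> norm (x * q) < 1 \<and> norm (q / x) < 1"

lemma rank_domain_powers:
  assumes "rank_domain q x"
  shows "norm (x * q ^ (2 * n + 1)) \<le> norm (x * q)" "norm (q ^ (2 * n + 1) / x) \<le> norm (q / x)"
proof -
  have "norm (q ^ (2 * n)) \<le> 1"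
    using assms by (simp add: rank_domain_def norm_power power_le_one)
  then have "norm (c * q ^ (2 * n)) \<le> norm c" for c
    by (simp add: norm_mult mult_left_le)
  from this[of "x * q"] this[of "q / x"]
  show "norm (x * q ^ (2 * n + 1)) \<le> norm (x * q)" "norm (q ^ (2 * n + 1) / x) \<le> norm (q / x)"
    by (simp_all add: mult_ac)
qed

lemma rank_factor_neq_0:
  assumes "rank_domain q x"
  shows "rank_factor q x n \<noteq> 0"
proof -
  have "norm (x * q ^ (2 * n + 1)) < 1" "norm (q ^ (2 * n + 1) / x) < 1"
    using rank_domain_powers[OF assms, of n] assms by (auto simp: rank_domain_def)
  then show ?thesis
    unfolding rank_factor_def mult_eq_0_iff using one_minus_neq_0 by blast
qed

text \<open>Summing \<open>bailey_kernel_step\<close> against \<open>c n / rank_factor q x n\<close>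
  cancels the rank factor at \<open>n\<close>. What remains is a first-order recurrence in
  \<open>t\<close>, of the same shape as the one satisfied by \<open>row_gf\<close>.\<close>

lemma bailey_sum_step:
  fixes c :: "nat \<Rightarrow> complex"
  assumes x: "rank_domain q x"
  defines "Y \<equiv> \<lambda>s. \<Sum>n\<le>s. c n / rank_factor q x n * bailey_kernel (q\<^sup>2) s n"
  shows "rank_factor q x (Suc t) * Y (Suc t)
      = Y t + (\<Sum>n\<le>Suc t. c n * q ^ (2 * (Suc t - n)) * bailey_kernel (q\<^sup>2) (Suc t) n)"
proof -
  have q: "norm q < 1" and x0: "x \<noteq> 0"
    using x by (auto simp: rank_domain_def)
  note nz = rank_factor_neq_0[OF x]
  have ext: "Y t = (\<Sum>n\<le>Suc t. c n / rank_factor q x n * bailey_kernel (q\<^sup>2) t n)"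
    unfolding Y_def sum.atMost_Suc by (simp add: bailey_kernel_def[of _ t "Suc t"])
  have "rank_factor q x (Suc t) * Y (Suc t) - Y t
    = (\<Sum>n\<le>Suc t. c n / rank_factor q x n
        * (rank_factor q x (Suc t) * bailey_kernel (q\<^sup>2) (Suc t) n - bailey_kernel (q\<^sup>2) t n))"
    unfolding ext unfolding Y_def sum_distrib_left sum_subtractf[symmetric]
    by (intro sum.cong refl) (simp only: right_diff_distrib mult_ac)
  also have "\<dots> = (\<Sum>n\<le>Suc t. c n * q ^ (2 * (Suc t - n)) * bailey_kernel (q\<^sup>2) (Suc t) n)"
  proof (rule sum.cong[OF refl])
    fix n assume n: "n \<in> {..Suc t}"
    show "c n / rank_factor q x n
        * (rank_factor q x (Suc t) * bailey_kernel (q\<^sup>2) (Suc t) n - bailey_kernel (q\<^sup>2) t n)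
      = c n * q ^ (2 * (Suc t - n)) * bailey_kernel (q\<^sup>2) (Suc t) n"
      using n nz[of n] by (subst bailey_kernel_step[OF q x0]) simp_all
  qed
  finally show ?thesis
    by (simp add: algebra_simps)
qed

text \<open>Both sides satisfy the same first-order recurrence in \<open>t\<close>, with the nonzero
  rank factor at \<open>t + 1\<close> in front of the new value, so an induction on \<open>t\<close>
  inside the one on \<open>j\<close> identifies them. The inhomogeneous term is zero for one color,
  and \<open>q ^ (2 * t + 3)\<close> times the value for one color less otherwise.\<close>

lemma row_gf_eq_bailey_sum:
  assumes "\<And>i. i \<in> {1..j + 1} \<Longrightarrow> rank_domain q (x i)"
  shows "row_gf q x j t = (\<Sum>n\<le>t. row_coeff q x j n * bailey_kernel (q\<^sup>2) t n)"
  using assms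
proof (induction j arbitrary: t)
  case 0
  have x1: "rank_domain q (x 1)" and q: "norm q < 1"
    using 0[of 1] by (simp_all add: rank_domain_def)
  \<comment> \<open>The extra \<open>2 * n\<close> in the exponent joins
    \<open>q ^ (2 * (t - n))\<close> to form \<open>q ^ (2 * t)\<close>, which leaves the unit
    Bailey sum. This power is harmless, as that sum is nonzero only at \<open>t = 0\<close>.\<close>
  define c where "c n = (1 - q ^ (4 * n + 2)) * (- 1) ^ n * q ^ (n * (n - 1) + 2 * n)" for n
  have coeff: "row_coeff q x 0 n = c n / rank_factor q (x 1) n" for n
  proof -
    have "n\<^sup>2 + (2 * 0 + 1) * n + 0 = n * (n - 1) + 2 * n"
      by (cases n) (simp_all add: power2_eq_square)
    then show ?thesis
      unfolding row_coeff_def c_def by (simp only:) simp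
  qed
  have c: "(\<Sum>n\<le>t. c n * q ^ (2 * (t - n)) * bailey_kernel (q\<^sup>2) t n) = (if t = 0 then 1 else 0)" for t
  proof -
    have "(\<Sum>n\<le>t. c n * q ^ (2 * (t - n)) * bailey_kernel (q\<^sup>2) t n)
      = q ^ (2 * t) * (\<Sum>n\<le>t. (1 - q ^ (4 * n + 2)) * (- 1) ^ n * q ^ (n * (n - 1)) * bailey_kernel (q\<^sup>2) t n)"
      unfolding sum_distrib_left
    proof (rule sum.cong[OF refl])
      fix n assume "n \<in> {..t}"
      then have "2 * t = 2 * n + 2 * (t - n)"
        by simp
      then have "q ^ (2 * t) = q ^ (2 * n) * q ^ (2 * (t - n))"
        by (simp only: power_add)
      then show "c n * q ^ (2 * (t - n)) * bailey_kernel (q\<^sup>2) t n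
        = q ^ (2 * t) * ((1 - q ^ (4 * n + 2)) * (- 1) ^ n * q ^ (n * (n - 1)) * bailey_kernel (q\<^sup>2) t n)"
        by (simp add: c_def power_add mult_ac)
    qed
    then show ?thesis
      using unit_bailey_sum[OF q, of t] by simp
  qed
  show ?case
  proof (induction t)
    case 0
    then show ?case
      using c[of 0] rank_factor_neq_0[OF x1, of 0] by (simp add: coeff field_simps)
  next
    case (Suc t)
    have "rank_factor q (x 1) (Suc t) * (\<Sum>n\<le>Suc t. row_coeff q x 0 n * bailey_kernel (q\<^sup>2) (Suc t) n)
        = row_gf q x 0 t"
      using bailey_sum_step[OF x1, where c = c and t = t] c[of "Suc t"] Suc by (simp add: coeff)
    then have "(\<Sum>n\<le>Suc t. row_coeff q x 0 n * bailey_kernel (q\<^sup>2) (Suc t) n)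
        = row_gf q x 0 t / rank_factor q (x 1) (Suc t)"
      using rank_factor_neq_0[OF x1, of "Suc t"] by (metis nonzero_mult_div_cancel_left)
    also have "\<dots> = row_gf q x 0 (Suc t)"
      by (simp add: prod.nat_ivl_Suc')
    finally show ?case ..
  qed
next
  case (Suc j)
  define y where "y = x (j + 2)"
  have y: "rank_domain q y"
    using Suc.prems[of "j + 2"] by (simp add: y_def)
  have xy: "x (Suc (Suc j)) = y"
    by (simp add: y_def)
  from y have q: "norm q < 1"
    by (simp add: rank_domain_def)
  note nz = rank_factor_neq_0[OF y]
  have IH: "row_gf q x j t = (\<Sum>n\<le>t. row_coeff q x j n * bailey_kernel (q\<^sup>2) t n)" for t
    using Suc by simp
  define c where "c n = row_coeff q x j n * q ^ (2 * n + 1)" for n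
  have coeff: "row_coeff q x (Suc j) n = c n / rank_factor q y n" for n
  proof -
    have p: "(\<Prod>i = 1..Suc j + 1. rank_factor q (x i) n) = (\<Prod>i = 1..j + 1. rank_factor q (x i) n) * rank_factor q y n"
      by (simp add: y_def)
    have e: "n\<^sup>2 + (2 * Suc j + 1) * n + Suc j = (n\<^sup>2 + (2 * j + 1) * n + j) + (2 * n + 1)"
      by (simp add: algebra_simps)
    show ?thesis
      unfolding row_coeff_def c_def p e power_add[of q "n\<^sup>2 + (2 * j + 1) * n + j" "2 * n + 1"]
      by (simp only: times_divide_eq_left divide_divide_eq_left mult.assoc)
  qed
  have c: "(\<Sum>n\<le>t. c n * q ^ (2 * (t - n)) * bailey_kernel (q\<^sup>2) t n) = q ^ (2 * t + 1) * row_gf q x j t" for t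
    unfolding IH sum_distrib_left
  proof (rule sum.cong[OF refl])
    fix n assume "n \<in> {..t}"
    then have "2 * t + 1 = (2 * n + 1) + 2 * (t - n)"
      by simp
    then have "q ^ (2 * t + 1) = q ^ (2 * n + 1) * q ^ (2 * (t - n))"
      by (simp only: power_add)
    then show "c n * q ^ (2 * (t - n)) * bailey_kernel (q\<^sup>2) t n
      = q ^ (2 * t + 1) * (row_coeff q x j n * bailey_kernel (q\<^sup>2) t n)"
      by (simp only: c_def mult_ac)
  qed
  show ?case
  proof (induction t)
    case 0
    then show ?case
      using c[of 0] nz[of 0] by (simp add: coeff field_simps xy)
  next
    case (Suc t)
    have "rank_factor q y (Suc t) * row_gf q x (Suc j) (Suc t)
       = row_gf q x (Suc j) t + q ^ (2 * Suc t + 1) * row_gf q x j (Suc t)"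
    proof -
      \<comment> \<open>The terms with \<open>M \<le> t\<close> lose their factor at
        \<open>l = t + 1\<close> and add up to the previous value; the remaining term
        \<open>M = t + 1\<close> is the inhomogeneity.\<close>
      have "rank_factor q y (Suc t) * (\<Sum>M\<le>t. q ^ (2 * M + 1) * row_gf q x j M / (\<Prod>l\<in>{M..Suc t}. rank_factor q y l))
        = row_gf q x (Suc j) t"
        unfolding row_gf.simps y_def[symmetric] sum_distrib_left
        using nz[of "Suc t"] by (intro sum.cong refl) (simp add: prod.nat_ivl_Suc')
      then show ?thesis
        using nz[of "Suc t"] by (simp add: distrib_left xy)
    qed
    also have "\<dots> = rank_factor q y (Suc t) * (\<Sum>n\<le>Suc t. row_coeff q x (Suc j) n * bailey_kernel (q\<^sup>2) (Suc t) n)"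
      using bailey_sum_step[OF y, where c = c and t = t] c[of "Suc t"] Suc by (simp add: coeff)
    finally show ?case
      using nz[of "Suc t"] by simp
  qed
qed

section \<open>The q-Gauss summation\<close>

text \<open>The ratio is a separate sequence \<open>r\<close> and not a quotient of consecutive
  terms, so \<open>f\<close> may have zeros, as a terminating q-series does.\<close>

lemma ratio_tendsto_imp_summable:
  fixes f r :: "nat \<Rightarrow> complex"
  assumes r: "r \<longlonglongrightarrow> l" and l: "norm l < 1" and f: "\<And>n. f (Suc n) = f n * r n"
  shows "summable (\<lambda>n. norm (f n))"
proof -
  define c where "c = (1 + norm l) / 2"
  have c: "norm l < c" "c < 1"
    using l by (simp_all add: c_def)
  have "eventually (\<lambda>n. norm (r n) < c) sequentially"
    using order_tendstoD(2)[OF tendsto_norm[OF r] c(1)] .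
  then obtain N where N: "\<And>n. n \<ge> N \<Longrightarrow> norm (r n) < c"
    by (auto simp: eventually_sequentially)
  show ?thesis
  proof (rule summable_ratio_test[OF c(2)])
    fix n assume "n \<ge> N"
    then show "norm (norm (f (Suc n))) \<le> c * norm (norm (f n))"
      using N[of n] by (simp add: f norm_mult mult_right_mono mult.commute[of c] mult_left_mono)
  qed
qed

lemma qfac_LIMSEQ:
  assumes "norm p < 1"
  shows "qfac c p \<longlonglongrightarrow> qpoch1 c p \<infinity>"
    and "(\<And>l. 1 - c * p ^ l \<noteq> 0) \<Longrightarrow> qpoch1 c p \<infinity> \<noteq> 0"
proof -
  have "summable (\<lambda>l. norm (1 - c * p ^ l - 1))"
    using assms by (simp add: norm_mult norm_power summable_mult)
  then have conv: "convergent_prod (\<lambda>l. 1 - c * p ^ l)"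
    by (intro abs_convergent_prod_imp_convergent_prod summable_imp_abs_convergent_prod)
  show "qfac c p \<longlonglongrightarrow> qpoch1 c p \<infinity>"
    using convergent_prod_LIMSEQ[OF conv]
    unfolding LIMSEQ_lessThan_iff_atMost[symmetric] by (simp add: qfac_def[abs_def] qpoch1_def)
  show "qpoch1 c p \<infinity> \<noteq> 0" if "\<And>l. 1 - c * p ^ l \<noteq> 0"
    using prodinf_nonzero[OF conv that] by (simp add: qpoch1_def)
qed

lemma qpoch1_inf_neq_0:
  assumes "norm p < 1" "norm c < 1"
  shows "qpoch1 c p \<infinity> \<noteq> 0"
  by (intro qfac_LIMSEQ(2)[OF assms(1)] one_minus_neq_0 norm_power_mult_less_1) (use assms in auto)

lemma qpoch1_inf_split:
  assumes "norm p < 1"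
  shows "qpoch1 c p \<infinity> = qfac c p n * qpoch1 (c * p ^ n) p \<infinity>"
proof (rule LIMSEQ_unique)
  show "(\<lambda>m. qfac c p (m + n)) \<longlonglongrightarrow> qpoch1 c p \<infinity>"
    using qfac_LIMSEQ(1)[OF assms] by (rule LIMSEQ_ignore_initial_segment)
  show "(\<lambda>m. qfac c p (m + n)) \<longlonglongrightarrow> qfac c p n * qpoch1 (c * p ^ n) p \<infinity>"
    unfolding add.commute[of _ n] qfac_add by (intro tendsto_intros qfac_LIMSEQ(1) assms)
qed

lemma norm_qfac_le: "norm p \<le> 1 \<Longrightarrow> norm (qfac c p n) \<le> (1 + norm c) ^ n"
proof (induction n)
  case (Suc n)
  have "norm (1 - c * p ^ n) \<le> 1 + norm c * norm p ^ n"
    by (rule order.trans[OF norm_triangle_ineq4]) (simp add: norm_mult norm_power)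
  also have "\<dots> \<le> 1 + norm c"
    using Suc.prems by (simp add: mult_left_le power_le_one)
  finally show ?case
    using Suc by (simp add: qfac_Suc norm_mult mult_mono mult.commute[of "1 + norm c"])
qed simp

text \<open>The constant \<open>C\<close> instead of \<open>norm c\<close> makes the bound uniform
  over the lower parameters \<open>A * B * z * p ^ N\<close> in the limit of the iterated Gauss
  sum.\<close>

lemma norm_qfac_ge:
  assumes "norm p \<le> 1" "norm c \<le> C" "C < 1"
  shows "(1 - C) ^ n \<le> norm (qfac c p n)"
proof (induction n)
  case (Suc n)
  have "norm (c * p ^ n) \<le> C"
    using assms mult_mono[of "norm c" C "norm p ^ n" 1]
    by (simp add: norm_mult norm_power power_le_one order.trans[OF norm_ge_zero])
  then have "1 - C \<le> norm (1 - c * p ^ n)"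
    using norm_triangle_ineq2[of 1 "c * p ^ n"] by simp
  then show ?case
    using Suc assms by (simp add: qfac_Suc norm_mult mult_mono mult.commute[of "1 - C"])
qed simp

text \<open>The summand of Heine's series 2phi1 in base \<open>p\<close> at the argument
  \<open>z\<close>, with upper parameters \<open>A\<close>, \<open>B\<close> and lower parameter
  \<open>A * B * z\<close>.\<close>

definition gauss_term :: "complex \<Rightarrow> complex \<Rightarrow> complex \<Rightarrow> complex \<Rightarrow> nat \<Rightarrow> complex" where
  "gauss_term p A B z m = qfac A p m * qfac B p m * z ^ m / (qfac p p m * qfac (A * B * z) p m)"

lemma gauss_term_Suc:
  "gauss_term p A B z (Suc m) = gauss_term p A B z m *
    ((1 - A * p ^ m) * (1 - B * p ^ m) * z / ((1 - p * p ^ m) * (1 - A * B * z * p ^ m)))"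
  by (simp add: gauss_term_def qfac_Suc mult_ac)

lemma summable_gauss_term:
  assumes p: "norm p < 1" and z: "norm z < 1"
  shows "summable (\<lambda>m. norm (gauss_term p A B z m))"
proof (rule ratio_tendsto_imp_summable[OF _ z])
  show "gauss_term p A B z (Suc m) = gauss_term p A B z m *
    ((1 - A * p ^ m) * (1 - B * p ^ m) * z / ((1 - p * p ^ m) * (1 - A * B * z * p ^ m)))" for m
    by (rule gauss_term_Suc)
  have pow: "(\<lambda>m. p ^ m) \<longlonglongrightarrow> 0"
    using p by (rule LIMSEQ_power_zero)
  have "(\<lambda>m. (1 - A * p ^ m) * (1 - B * p ^ m) * z / ((1 - p * p ^ m) * (1 - A * B * z * p ^ m)))
      \<longlonglongrightarrow> (1 - A * 0) * (1 - B * 0) * z / ((1 - p * 0) * (1 - A * B * z * 0))"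
    by (intro tendsto_intros pow) auto
  then show "(\<lambda>m. (1 - A * p ^ m) * (1 - B * p ^ m) * z / ((1 - p * p ^ m) * (1 - A * B * z * p ^ m)))
      \<longlonglongrightarrow> z" by simp
qed

text \<open>A telescoping argument: a fixed linear combination of the terms at \<open>z\<close> and
  at \<open>z * p\<close> is the difference sequence of \<open>g m = - ((1 - p ^ m) * t m)\<close>,
  which is zero at \<open>m = 0\<close> and tends to zero.\<close>

lemma gauss_sum_contiguous:
  assumes p: "norm p < 1" and z: "norm z < 1" and C: "norm (A * B * z) < 1"
  shows "(\<Sum>m. gauss_term p A B z m)
    = (1 - A * z) * (1 - B * z) / ((1 - z) * (1 - A * B * z)) * (\<Sum>m. gauss_term p A B (z * p) m)"
proof -
  define t u where "t = gauss_term p A B z" and "u = gauss_term p A B (z * p)"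
  define g where "g m = - ((1 - p ^ m) * t m)" for m
  have zp: "norm (z * p) < 1"
    using norm_power_mult_less_1[of z p 1] p z by simp
  have t: "summable t" and u: "summable u"
    using summable_gauss_term[OF p z, of A B] summable_gauss_term[OF p zp, of A B]
    by (simp_all add: t_def u_def summable_norm_cancel)
  have nz: "1 - A * B * z * p ^ m \<noteq> 0" "1 - p * p ^ m \<noteq> 0" for m
    by (intro one_minus_neq_0 norm_power_mult_less_1; use p C in simp)+
  have nz0: "1 - A * B * z \<noteq> 0" "1 - z \<noteq> 0"
    using C z by (auto dest: one_minus_neq_0)
  have "(\<lambda>m. g m) \<longlonglongrightarrow> - ((1 - 0) * 0)"
    unfolding g_def using p by (intro tendsto_intros LIMSEQ_power_zero summable_LIMSEQ_zero t)
  then have "(\<lambda>m. g (Suc m) - g m) sums (- ((1 - 0) * 0) - g 0)"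
    by (rule telescope_sums)
  then have "(\<lambda>m. g (Suc m) - g m) sums 0"
    by (simp add: g_def)
  moreover have "g (Suc m) - g m = (1 - z) * t m - (1 - A * z) * (1 - B * z) / (1 - A * B * z) * u m" for m
  proof -
    define X where "X = p ^ m"
    \<comment> \<open>Passing from \<open>z\<close> to \<open>z * p\<close> also shifts the lower
      parameter to \<open>A * B * z * p\<close>. Its q-factorial arises from the old one by dropping
      the first factor and appending a new last one.\<close>
    have u: "u m = t m * X * (1 - A * B * z) / (1 - A * B * z * X)"
    proof -
      have "qfac (A * B * z) p (Suc m) = (1 - A * B * z) * qfac (A * B * z * p) p m"
        using qfac_add[of "A * B * z" p 1 m] by (simp add: qfac_Suc)
      then have "qfac (A * B * (z * p)) p m = qfac (A * B * z) p m * (1 - A * B * z * X) / (1 - A * B * z)"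
        using nz0 by (simp add: qfac_Suc X_def field_simps)
      then show ?thesis
        unfolding t_def u_def gauss_term_def power_mult_distrib by (simp add: X_def mult.assoc)
    qed
    have tS: "t (Suc m) = t m * ((1 - A * X) * (1 - B * X) * z / ((1 - p * X) * (1 - A * B * z * X)))"
      by (simp add: t_def gauss_term_Suc X_def)
    have "- ((1 - p * X) * (t m * ((1 - A * X) * (1 - B * X) * z / ((1 - p * X) * (1 - A * B * z * X))))) + (1 - X) * t m
      = (1 - z) * t m - (1 - A * z) * (1 - B * z) / (1 - A * B * z) * (t m * X * (1 - A * B * z) / (1 - A * B * z * X))"
      using nz[of m] nz0 unfolding X_def[symmetric] by (simp add: divide_simps) algebra
    then show ?thesis
      by (simp add: g_def tS u X_def)
  qed
  ultimately have "(\<lambda>m. (1 - z) * t m - (1 - A * z) * (1 - B * z) / (1 - A * B * z) * u m) sums 0"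
    by simp
  moreover have "(\<lambda>m. (1 - z) * t m - (1 - A * z) * (1 - B * z) / (1 - A * B * z) * u m)
      sums ((1 - z) * suminf t - (1 - A * z) * (1 - B * z) / (1 - A * B * z) * suminf u)"
    by (intro sums_diff sums_mult summable_sums t u)
  ultimately have "(1 - z) * suminf t = (1 - A * z) * (1 - B * z) / (1 - A * B * z) * suminf u"
    using sums_unique2 by fastforce
  then have "suminf t = (1 - A * z) * (1 - B * z) / (1 - A * B * z) * suminf u / (1 - z)"
    using nz0(2) by (metis nonzero_mult_div_cancel_left)
  then show ?thesis
    unfolding t_def u_def by (simp add: mult.commute)
qed

lemma gauss_sum_iterate:
  assumes p: "norm p < 1" and z: "norm z < 1" and C: "norm (A * B * z) < 1"
  shows "(\<Sum>m. gauss_term p A B z m)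
    = qfac (A * z) p N * qfac (B * z) p N / (qfac z p N * qfac (A * B * z) p N)
        * (\<Sum>m. gauss_term p A B (z * p ^ N) m)"
proof (induction N)
  case (Suc N)
  have "norm (z * p ^ N) < 1" "norm (A * B * (z * p ^ N)) < 1"
    using norm_power_mult_less_1[of z p N] norm_power_mult_less_1[of "A * B * z" p N] p z C
    by (simp_all add: mult_ac)
  from gauss_sum_contiguous[OF p this] show ?case
    unfolding Suc by (simp add: qfac_Suc mult_ac)
qed simp

text \<open>As the argument shrinks, only the term at \<open>m = 0\<close> survives: the term at
  \<open>m\<close> is at most \<open>y N ^ m\<close> with \<open>y N\<close> tending to zero, so the
  sum eventually differs from 1 by at most \<open>y N / (1 - y N)\<close>.\<close>

lemma gauss_sum_LIMSEQ_1:
  assumes p: "norm p < 1" and C: "norm (A * B * z) < 1"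
  shows "(\<lambda>N. \<Sum>m. gauss_term p A B (z * p ^ N) m) \<longlonglongrightarrow> 1"
proof -
  \<comment> \<open>Each of the four q-factorials is bounded by an \<open>m\<close>-th power, and
    \<open>K\<close> collects the bases. It is independent of \<open>N\<close> because multiplying
    by \<open>p ^ N\<close> does not increase the absolute value of the lower parameter.\<close>
  define K where "K = (1 + norm A) * (1 + norm B) / ((1 - norm p) * (1 - norm (A * B * z)))"
  define y where "y N = K * norm (z * p ^ N)" for N
  have K: "K \<ge> 0"
    using p C by (simp add: K_def)
  have term_le: "norm (gauss_term p A B (z * p ^ N) m) \<le> y N ^ m" for N m
  proof -
    have c: "norm (A * B * (z * p ^ N)) \<le> norm (A * B * z)"
      using p by (simp add: norm_mult norm_power power_le_one mult_left_le mult.assoc mult_left_mono)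
    have "norm (gauss_term p A B (z * p ^ N) m)
        = norm (qfac A p m) * norm (qfac B p m) * norm (z * p ^ N) ^ m
          / (norm (qfac p p m) * norm (qfac (A * B * (z * p ^ N)) p m))"
      by (simp add: gauss_term_def norm_mult norm_divide norm_power)
    also have "\<dots> \<le> (1 + norm A) ^ m * (1 + norm B) ^ m * norm (z * p ^ N) ^ m
          / ((1 - norm p) ^ m * (1 - norm (A * B * z)) ^ m)"
      using p C c
      by (intro frac_le mult_mono norm_qfac_le norm_qfac_ge mult_nonneg_nonneg mult_pos_pos zero_less_power) auto
    also have "\<dots> = y N ^ m"
      by (simp add: y_def K_def power_mult_distrib power_divide)
    finally show ?thesis .
  qed
  have y0: "y \<longlonglongrightarrow> 0"
  proof -
    have "(\<lambda>N. K * norm (z * p ^ N)) \<longlonglongrightarrow> K * norm (z * 0)"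
      using p by (intro tendsto_intros LIMSEQ_power_zero)
    then show ?thesis by (simp add: y_def[abs_def])
  qed
  have "(\<lambda>N. (\<Sum>m. gauss_term p A B (z * p ^ N) m) - 1) \<longlonglongrightarrow> 0"
  proof (rule Lim_null_comparison)
    have "(\<lambda>N. y N / (1 - y N)) \<longlonglongrightarrow> 0 / (1 - 0)"
      by (intro tendsto_intros y0) simp
    then show "(\<lambda>N. y N / (1 - y N)) \<longlonglongrightarrow> 0" by simp
    show "eventually (\<lambda>N. norm ((\<Sum>m. gauss_term p A B (z * p ^ N) m) - 1) \<le> y N / (1 - y N)) sequentially"
      using order_tendstoD(2)[OF y0 zero_less_one]
    proof eventually_elim
      case (elim N)
      let ?f = "gauss_term p A B (z * p ^ N)"
      have y: "0 \<le> y N" "y N < 1" "norm (y N) < 1"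
        using K elim by (simp_all add: y_def)
      have geo: "(\<lambda>m. y N * y N ^ m) sums (y N * (1 / (1 - y N)))"
        by (intro sums_mult geometric_sums y)
      have "summable ?f"
        using y(3) term_le by (intro summable_comparison_test'[OF summable_geometric[of "y N"]]) auto
      then have "suminf ?f - 1 = (\<Sum>m. ?f (Suc m))"
        by (subst suminf_split_head) (simp_all add: gauss_term_def)
      also have "norm \<dots> \<le> (\<Sum>m. y N * y N ^ m)"
        using term_le[of N "Suc _"] geo by (intro norm_suminf_le) (auto simp: sums_iff)
      also have "\<dots> = y N / (1 - y N)"
        using geo by (simp add: sums_iff)
      finally show ?case .
    qed
  qed
  then show ?thesis
    by (simp add: LIM_zero_iff)
qed

text \<open>
  The classical lower parameter is \<open>C = A * B * z\<close>; eliminating \<open>C\<close> instead of \<open>z\<close> admits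
  \<open>A = 0\<close> and \<open>B = 0\<close>, which occur for \<open>q = 0\<close>.
\<close>

theorem q_gauss_sum:
  assumes p: "norm p < 1" and z: "norm z < 1" and C: "norm (A * B * z) < 1"
  shows "gauss_term p A B z sums
    (qpoch1 (A * z) p \<infinity> * qpoch1 (B * z) p \<infinity> / (qpoch1 z p \<infinity> * qpoch1 (A * B * z) p \<infinity>))"
proof -
  have "(\<lambda>N. qfac (A * z) p N * qfac (B * z) p N / (qfac z p N * qfac (A * B * z) p N)
        * (\<Sum>m. gauss_term p A B (z * p ^ N) m))
    \<longlonglongrightarrow> qpoch1 (A * z) p \<infinity> * qpoch1 (B * z) p \<infinity>
          / (qpoch1 z p \<infinity> * qpoch1 (A * B * z) p \<infinity>) * 1"
    using p z C
    by (intro tendsto_intros qfac_LIMSEQ(1) gauss_sum_LIMSEQ_1 no_zero_divisors qpoch1_inf_neq_0)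
  then have "(\<lambda>N::nat. \<Sum>m. gauss_term p A B z m)
    \<longlonglongrightarrow> qpoch1 (A * z) p \<infinity> * qpoch1 (B * z) p \<infinity>
          / (qpoch1 z p \<infinity> * qpoch1 (A * B * z) p \<infinity>)"
    unfolding gauss_sum_iterate[OF assms, symmetric] by simp
  then have "(\<Sum>m. gauss_term p A B z m) = qpoch1 (A * z) p \<infinity> * qpoch1 (B * z) p \<infinity>
          / (qpoch1 z p \<infinity> * qpoch1 (A * B * z) p \<infinity>)"
    by (simp add: LIMSEQ_const_iff)
  moreover have "summable (gauss_term p A B z)"
    using summable_gauss_term[OF p z] by (rule summable_norm_cancel)
  ultimately show ?thesis
    by (simp add: sums_iff)
qed

section \<open>Summation over the bound on the parts\<close>

text \<open>Unconditional summability of complex families is absolute; summing the norms iteratively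
  supplies the summability on the product.\<close>

lemma has_sum_product:
  fixes f :: "'a \<Rightarrow> complex" and g :: "'b \<Rightarrow> complex"
  assumes f: "(f has_sum a) A" and g: "(g has_sum b) B"
  shows "((\<lambda>(x, y). f x * g y) has_sum (a * b)) (A \<times> B)"
proof (rule has_sum_SigmaI)
  show "((\<lambda>y. case (x, y) of (x, y) \<Rightarrow> f x * g y) has_sum (f x * b)) B" for x
    using has_sum_cmult_right[OF g] by simp
  show "((\<lambda>x. f x * b) has_sum (a * b)) A"
    by (rule has_sum_cmult_left[OF f])
  have "(\<lambda>x. norm (f x)) summable_on A" "(\<lambda>y. norm (g y)) summable_on B"
    using summable_on_iff_abs_summable_on_complex has_sum_imp_summable f g by blast+
  then have "(\<lambda>z. norm (case z of (x, y) \<Rightarrow> f x * g y)) summable_on A \<times> B"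
    by (subst Infinite_Sum.abs_summable_on_Sigma_iff)
      (auto simp: norm_mult infsum_cmult_right' abs_mult infsum_nonneg intro!: summable_on_cmult_left summable_on_cmult_right)
  then show "(\<lambda>(x, y). f x * g y) summable_on A \<times> B"
    by (rule abs_summable_summable)
qed

text \<open>
  The contribution of \<open>\<lambda>\<close>, \<open>\<mu>\<close> and \<open>2 * t + 1\<close>: the odd number \<open>2 * j + 1\<close> is either
  missing, with weight \<open>a\<close> or \<open>b\<close>, or a part, with weight \<open>q ^ (2 * j + 1)\<close>.
\<close>

definition side_weight :: "complex \<Rightarrow> complex \<Rightarrow> complex \<Rightarrow> nat \<Rightarrow> complex" where
  "side_weight q a b t = q ^ (2 * t + 1) * (\<Prod>j<t. (a + q ^ (2 * j + 1)) * (b + q ^ (2 * j + 1)))"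

text \<open>The ratio of consecutive weights tends to \<open>a * b * q^2\<close>, the same quantity
  that later becomes the argument of the q-Gauss sum.\<close>

lemma summable_side_weight:
  assumes q: "norm q < 1" and ab: "norm (a * b * q\<^sup>2) < 1"
  shows "summable (\<lambda>t. norm (side_weight q a b t))"
proof (rule ratio_tendsto_imp_summable[OF _ ab])
  show "side_weight q a b (Suc t)
      = side_weight q a b t * ((a + q * (q\<^sup>2) ^ t) * (b + q * (q\<^sup>2) ^ t) * q\<^sup>2)" for t
  proof -
    have e: "q * (q\<^sup>2) ^ t = q ^ (2 * t + 1)"
      by (simp add: power_mult)
    show ?thesis
      unfolding e side_weight_def by (simp add: power2_eq_square mult_ac)
  qed
  have "norm (q\<^sup>2) < 1"
    using q by (simp add: norm_power power_less_one_iff)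
  then have "(\<lambda>t. (a + q * (q\<^sup>2) ^ t) * (b + q * (q\<^sup>2) ^ t) * q\<^sup>2) \<longlonglongrightarrow> (a + q * 0) * (b + q * 0) * q\<^sup>2"
    by (intro tendsto_intros LIMSEQ_power_zero)
  then show "(\<lambda>t. (a + q * (q\<^sup>2) ^ t) * (b + q * (q\<^sup>2) ^ t) * q\<^sup>2) \<longlonglongrightarrow> a * b * q\<^sup>2"
    by simp
qed

lemma prod_add_power_eq_qfac:
  assumes "a \<noteq> 0"
  shows "(\<Prod>j<m. a + c * p ^ j) = a ^ m * qfac (- c / a) p m"
  using assms by (induction m) (simp_all add: qfac_Suc field_simps)

text \<open>Extracting \<open>a\<close> and \<open>b\<close> from the factors beyond
  \<open>n\<close> exhibits the data of a q-Gauss sum: upper parameters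
  \<open>- (q ^ (2 * n + 1)) / a\<close> and \<open>- (q ^ (2 * n + 1)) / b\<close>, argument
  \<open>a * b * q^2\<close>.\<close>

lemma side_weight_add:
  assumes "a \<noteq> 0" "b \<noteq> 0"
  shows "side_weight q a b (n + m) = side_weight q a b n
    * (qfac (- (q ^ (2 * n + 1)) / a) (q\<^sup>2) m * qfac (- (q ^ (2 * n + 1)) / b) (q\<^sup>2) m * (a * b * q\<^sup>2) ^ m)"
proof -
  have split: "(\<Prod>j<n + m. f j) = (\<Prod>j<n. f j) * (\<Prod>j<m. f (n + j))" for f :: "nat \<Rightarrow> complex"
    by (induction m) (simp_all add: mult.assoc)
  have "q ^ (2 * (n + j) + 1) = q ^ (2 * n + 1) * (q\<^sup>2) ^ j" for j
    by (simp add: power_add power_mult)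
  then have "(\<Prod>j<m. (a + q ^ (2 * (n + j) + 1)) * (b + q ^ (2 * (n + j) + 1)))
      = (a ^ m * qfac (- (q ^ (2 * n + 1)) / a) (q\<^sup>2) m) * (b ^ m * qfac (- (q ^ (2 * n + 1)) / b) (q\<^sup>2) m)"
    unfolding prod_add_power_eq_qfac[OF assms(1), symmetric] prod_add_power_eq_qfac[OF assms(2), symmetric]
    by (simp only: prod.distrib)
  moreover have "q ^ (2 * (n + m) + 1) = q ^ (2 * n + 1) * (q\<^sup>2) ^ m"
    by (simp add: power_add power_mult)
  ultimately show ?thesis
    unfolding side_weight_def split by (simp only: power_mult_distrib mult_ac)
qed

text \<open>Nonzero kernel values are products of two members of the sequence
  \<open>1 / qfac p p n\<close>, which converges because the infinite product does not
  vanish.\<close>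

lemma bailey_kernel_bounded:
  assumes p: "norm p < 1"
  obtains K where "K > 0" "\<And>t n. norm (bailey_kernel p t n) \<le> K"
proof -
  have "(\<lambda>n. inverse (qfac p p n)) \<longlonglongrightarrow> inverse (qpoch1 p p \<infinity>)"
    using p by (intro tendsto_intros qfac_LIMSEQ(1) qpoch1_inf_neq_0)
  then have "Bseq (\<lambda>n. inverse (qfac p p n))"
    by (intro convergent_imp_Bseq convergentI)
  then obtain K where K: "K > 0" "\<And>n. norm (inverse (qfac p p n)) \<le> K"
    by (auto simp: Bseq_def)
  show ?thesis
  proof
    show "K * K > 0"
      using K by simp
    show "norm (bailey_kernel p t n) \<le> K * K" for t n
      using K(1) mult_mono[OF K(2)[of "t - n"] K(2)[of "t + n + 1"]]
      by (simp add: bailey_kernel_def norm_mult norm_divide norm_inverse divide_inverse)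
  qed
qed

text \<open>The denominators stay above a positive constant \<open>D\<close> for all
  \<open>n\<close>, since \<open>|x q ^ (2 * n + 1)|\<close> and
  \<open>|q ^ (2 * n + 1) / x|\<close> are largest at \<open>n = 0\<close>; the power of
  \<open>q\<close> in the numerator is at most \<open>|q| ^ n\<close>.\<close>

lemma summable_row_coeff:
  assumes q: "norm q < 1" and x: "\<And>i. i \<in> {1..j + 1} \<Longrightarrow> rank_domain q (x i)"
  shows "summable (\<lambda>n. norm (row_coeff q x j n))"
proof -
  define D where "D = (\<Prod>i = 1..j + 1. (1 - norm (x i * q)) * (1 - norm (q / x i)))"
  have pos: "(1 - norm (x i * q)) * (1 - norm (q / x i)) > 0" if "i \<in> {1..j + 1}" for i
    using x[OF that] by (simp add: rank_domain_def)
  then have D: "D > 0"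
    unfolding D_def by (rule prod_pos)
  have fac: "(1 - norm (x i * q)) * (1 - norm (q / x i)) \<le> norm (rank_factor q (x i) n)"
    if "i \<in> {1..j + 1}" for i n
    unfolding rank_factor_def norm_mult[of "1 - _"]
  proof (rule mult_mono)
    show "1 - norm (x i * q) \<le> norm (1 - x i * q ^ (2 * n + 1))"
      using rank_domain_powers(1)[OF x[OF that], of n] norm_triangle_ineq2[of 1 "x i * q ^ (2 * n + 1)"] by simp
    show "1 - norm (q / x i) \<le> norm (1 - (q ^ (2 * n + 1)) / x i)"
      using rank_domain_powers(2)[OF x[OF that], of n] norm_triangle_ineq2[of 1 "q ^ (2 * n + 1) / x i"] by simp
    show "0 \<le> 1 - norm (q / x i)"
      using x[OF that] by (simp add: rank_domain_def)
  qed simp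
  have "norm (row_coeff q x j n) \<le> 2 / D * norm q ^ n" for n
  proof -
    have "norm (\<Prod>i = 1..j + 1. rank_factor q (x i) n) \<ge> D"
      unfolding D_def prod_norm[symmetric] using pos fac by (intro prod_mono conjI) (auto intro: less_imp_le)
    moreover have "norm (q ^ (4 * n + 2)) \<le> 1"
      unfolding norm_power using q by (intro power_le_one) simp_all
    then have "norm (1 - q ^ (4 * n + 2)) \<le> 2"
      using norm_triangle_ineq4[of 1 "q ^ (4 * n + 2)"] by (simp only: norm_one)
    moreover have "norm q ^ (n\<^sup>2 + (2 * j + 1) * n + j) \<le> norm q ^ n"
      using q by (intro power_decreasing) auto
    ultimately have "norm (1 - q ^ (4 * n + 2)) * norm q ^ (n\<^sup>2 + (2 * j + 1) * n + j)
        / norm (\<Prod>i = 1..j + 1. rank_factor q (x i) n) \<le> 2 * norm q ^ n / D"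
      using D by (intro frac_le mult_mono) auto
    then show ?thesis
      by (simp add: row_coeff_def norm_mult norm_divide norm_power)
  qed
  then have "norm (norm (row_coeff q x j n)) \<le> 2 / D * norm q ^ n" for n
    by simp
  moreover have "summable (\<lambda>n. 2 / D * norm q ^ n)"
    using q by (intro summable_mult summable_geometric) simp
  ultimately show ?thesis
    by (rule summable_comparison_test'[where N = 0, rotated])
qed

text \<open>Uniformity in \<open>t\<close> is read off from the Bailey sum: its kernel is bounded
  and its coefficients are absolutely summable.\<close>

lemma row_gf_bounded:
  assumes q: "norm q < 1" and x: "\<And>i. i \<in> {1..j + 1} \<Longrightarrow> rank_domain q (x i)"
  obtains K where "\<And>t. norm (row_gf q x j t) \<le> K"
proof -
  have p: "norm (q\<^sup>2) < 1"
    using q by (simp add: norm_power power_less_one_iff)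
  then obtain K where K: "K > 0" "\<And>t n. norm (bailey_kernel (q\<^sup>2) t n) \<le> K"
    using bailey_kernel_bounded by blast
  show ?thesis
  proof
    fix t
    have eq: "row_gf q x j t = (\<Sum>n\<le>t. row_coeff q x j n * bailey_kernel (q\<^sup>2) t n)"
      by (rule row_gf_eq_bailey_sum) (rule x)
    have summable: "summable (\<lambda>n. norm (row_coeff q x j n))"
      by (rule summable_row_coeff[OF q]) (rule x)
    have "norm (row_gf q x j t) \<le> (\<Sum>n\<le>t. norm (row_coeff q x j n) * K)"
      unfolding eq by (intro sum_norm_le) (simp add: K(2) norm_mult mult_left_mono)
    also have "\<dots> \<le> (\<Sum>n. norm (row_coeff q x j n)) * K"
      unfolding sum_distrib_right[symmetric] using K(1) summable
      by (intro mult_right_mono sum_le_suminf) auto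
    finally show "norm (row_gf q x j t) \<le> (\<Sum>n. norm (row_coeff q x j n)) * K" .
  qed
qed

text \<open>The terms with \<open>t < n\<close> vanish, and \<open>t = n + m\<close> gives a q-Gauss
  series in \<open>m\<close> with lower parameter \<open>q ^ (4 * n + 4)\<close>. In Bailey's
  language this is a conjugate Bailey pair.\<close>

lemma side_weight_bailey_kernel_sums:
  assumes q: "norm q < 1" and ab: "a \<noteq> 0" "b \<noteq> 0" "norm (a * b * q\<^sup>2) < 1"
    and nz: "\<And>j. 1 + a * q ^ (2 * j + 1) \<noteq> 0 \<and> 1 + b * q ^ (2 * j + 1) \<noteq> 0"
  shows "(\<lambda>t. side_weight q a b t * bailey_kernel (q\<^sup>2) t n) sums
    (side_weight q a b n
      * (qpoch1 (- a * q) (q\<^sup>2) \<infinity> * qpoch1 (- b * q) (q\<^sup>2) \<infinity>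
        / (qpoch1 (q\<^sup>2) (q\<^sup>2) \<infinity> * qpoch1 (a * b * q\<^sup>2) (q\<^sup>2) \<infinity>))
      / (qfac (- a * q) (q\<^sup>2) (n + 1) * qfac (- b * q) (q\<^sup>2) (n + 1)))"
proof -
  define p c where "p = q\<^sup>2" and "c = q ^ (2 * n + 1)"
  have p: "norm p < 1"
    using q by (simp add: p_def norm_power power_less_one_iff)
  have pz: "norm (p * p ^ m) < 1" for m
    using p by (intro norm_power_mult_less_1) simp_all
  have z: "norm (a * b * p) < 1"
    using ab by (simp add: p_def)
  have "c * c = p ^ (2 * n + 1)"
    unfolding c_def p_def power2_eq_square power_mult_distrib ..
  then have cp: "c * c * p = p * p ^ (2 * n + 1)"
    by simp
  have C: "(- c / a) * (- c / b) * (a * b * p) = p * p ^ (2 * n + 1)"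
    unfolding cp[symmetric] using ab by (simp add: mult_ac)
  have "gauss_term p (- c / a) (- c / b) (a * b * p) sums
     (qpoch1 (- b * c * p) p \<infinity> * qpoch1 (- a * c * p) p \<infinity>
       / (qpoch1 (a * b * p) p \<infinity> * qpoch1 (p * p ^ (2 * n + 1)) p \<infinity>))"
  proof -
    have e: "(- c / a) * (a * b * p) = - b * c * p" "(- c / b) * (a * b * p) = - a * c * p"
      using ab by simp_all
    show ?thesis
      using q_gauss_sum[OF p z, of "- c / a" "- c / b"] pz unfolding C e by blast
  qed
  then have "(\<lambda>m. side_weight q a b n / qfac p p (2 * n + 1) * gauss_term p (- c / a) (- c / b) (a * b * p) m) sums
    (side_weight q a b n / qfac p p (2 * n + 1) *
     (qpoch1 (- b * c * p) p \<infinity> * qpoch1 (- a * c * p) p \<infinity>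
       / (qpoch1 (a * b * p) p \<infinity> * qpoch1 (p * p ^ (2 * n + 1)) p \<infinity>)))"
    by (rule sums_mult)
  moreover have "side_weight q a b n / qfac p p (2 * n + 1) * gauss_term p (- c / a) (- c / b) (a * b * p) m
    = side_weight q a b (m + n) * bailey_kernel p (m + n) n" for m
  proof -
    have "qfac p p (m + n + n + 1) = qfac p p (2 * n + 1) * qfac (p * p ^ (2 * n + 1)) p m"
      using qfac_add[of p p "2 * n + 1" m] by (simp add: mult_2 add_ac)
    then have "bailey_kernel p (m + n) n = 1 / (qfac p p m * (qfac p p (2 * n + 1) * qfac (p * p ^ (2 * n + 1)) p m))"
      by (simp add: bailey_kernel_def)
    then show ?thesis
      unfolding gauss_term_def C add.commute[of m n] side_weight_add[OF ab(1,2)] p_def[symmetric] c_def[symmetric]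
      by simp
  qed
  ultimately have "(\<lambda>m. side_weight q a b (m + n) * bailey_kernel p (m + n) n) sums
    (side_weight q a b n / qfac p p (2 * n + 1) *
     (qpoch1 (- b * c * p) p \<infinity> * qpoch1 (- a * c * p) p \<infinity>
       / (qpoch1 (a * b * p) p \<infinity> * qpoch1 (p * p ^ (2 * n + 1)) p \<infinity>)))"
    by simp
  then have "(\<lambda>t. side_weight q a b t * bailey_kernel p t n) sums
    (side_weight q a b n / qfac p p (2 * n + 1) *
     (qpoch1 (- b * c * p) p \<infinity> * qpoch1 (- a * c * p) p \<infinity>
       / (qpoch1 (a * b * p) p \<infinity> * qpoch1 (p * p ^ (2 * n + 1)) p \<infinity>)))"
    by (rule sums_zero_iff_shift[THEN iffD1, rotated]) (simp add: bailey_kernel_def)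
  moreover have "side_weight q a b n / qfac p p (2 * n + 1) *
     (qpoch1 (- b * c * p) p \<infinity> * qpoch1 (- a * c * p) p \<infinity>
       / (qpoch1 (a * b * p) p \<infinity> * qpoch1 (p * p ^ (2 * n + 1)) p \<infinity>))
    = side_weight q a b n
      * (qpoch1 (- a * q) p \<infinity> * qpoch1 (- b * q) p \<infinity>
        / (qpoch1 p p \<infinity> * qpoch1 (a * b * p) p \<infinity>))
      / (qfac (- a * q) p (n + 1) * qfac (- b * q) p (n + 1))"
  proof -
    \<comment> \<open>As \<open>c * p = q * p ^ (n + 1)\<close>, the numerator products of the
      q-Gauss value are tails of those in the claim. The \<open>n + 1\<close> leading factors split
      off here form the finite denominator.\<close>
    have cqp: "c * p = q * p ^ (n + 1)"
      by (simp add: c_def p_def power_mult)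
    have e: "qpoch1 (- d * q) p \<infinity> = qfac (- d * q) p (n + 1) * qpoch1 (- d * c * p) p \<infinity>" for d
    proof -
      have "- d * c * p = - d * q * p ^ (n + 1)"
        by (simp only: mult.assoc cqp)
      then show ?thesis
        using qpoch1_inf_split[OF p, of "- d * q" "n + 1"] by (simp only:)
    qed
    have e': "qpoch1 p p \<infinity> = qfac p p (2 * n + 1) * qpoch1 (p * p ^ (2 * n + 1)) p \<infinity>"
      by (rule qpoch1_inf_split[OF p])
    have "qfac (- a * q) p (n + 1) \<noteq> 0" "qfac (- b * q) p (n + 1) \<noteq> 0"
      using nz by (auto simp: qfac_def p_def mult.assoc simp flip: power_mult)
    then show ?thesis
      unfolding e e' by (simp add: mult_ac)
  qed
  ultimately show ?thesis
    unfolding p_def by simp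
qed

lemma side_weight_eq_qfac:
  assumes "a \<noteq> 0" "b \<noteq> 0"
  shows "side_weight q a b n
      = q ^ (2 * n + 1) * (a * b) ^ n * (qfac (- q / a) (q\<^sup>2) n * qfac (- q / b) (q\<^sup>2) n)"
proof -
  have "q ^ (2 * j + 1) = q * (q\<^sup>2) ^ j" for j
    by (simp add: power_mult)
  then show ?thesis
    unfolding side_weight_def prod.distrib
    by (simp only: prod_add_power_eq_qfac[OF assms(1)] prod_add_power_eq_qfac[OF assms(2)]
        power_mult_distrib mult_ac)
qed

text \<open>The double family over \<open>n\<close> and \<open>t\<close> is dominated by a constant
  times the product of the summable families \<open>row_coeff\<close> and
  \<open>side_weight\<close>, as the kernel is bounded. Its sum may thus be evaluated in either
  order.\<close>

lemma bailey_transform: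
  assumes q: "norm q < 1" and ab: "a \<noteq> 0" "b \<noteq> 0" "norm (a * b * q\<^sup>2) < 1"
    and nz: "\<And>j. 1 + a * q ^ (2 * j + 1) \<noteq> 0 \<and> 1 + b * q ^ (2 * j + 1) \<noteq> 0"
    and x: "\<And>i. i \<in> {1..j + 1} \<Longrightarrow> rank_domain q (x i)"
  defines "P \<equiv> qpoch1 (- a * q) (q\<^sup>2) \<infinity> * qpoch1 (- b * q) (q\<^sup>2) \<infinity>
        / (qpoch1 (q\<^sup>2) (q\<^sup>2) \<infinity> * qpoch1 (a * b * q\<^sup>2) (q\<^sup>2) \<infinity>)"
    and "G \<equiv> \<lambda>n. row_coeff q x j n * side_weight q a b n
        / (qfac (- a * q) (q\<^sup>2) (n + 1) * qfac (- b * q) (q\<^sup>2) (n + 1))"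
  shows "summable G" and "((\<lambda>t. side_weight q a b t * row_gf q x j t) has_sum (P * suminf G)) UNIV"
proof -
  have p: "norm (q\<^sup>2) < 1"
    using q by (simp add: norm_power power_less_one_iff)
  obtain K where K: "K > 0" "\<And>t n. norm (bailey_kernel (q\<^sup>2) t n) \<le> K"
    using bailey_kernel_bounded[OF p] by blast
  have "summable (\<lambda>n. norm (row_coeff q x j n))"
    by (rule summable_row_coeff[OF q]) (rule x)
  then have rc: "row_coeff q x j summable_on UNIV"
    by (rule norm_summable_imp_summable_on)
  have sw: "side_weight q a b summable_on UNIV"
    by (intro norm_summable_imp_summable_on summable_side_weight q ab)
  define T where "T = (\<lambda>(n, t). row_coeff q x j n * (side_weight q a b t * bailey_kernel (q\<^sup>2) t n))"
  have "(\<lambda>(n, t). row_coeff q x j n * side_weight q a b t) summable_on UNIV \<times> UNIV"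
    using has_sum_product[OF has_sum_infsum[OF rc] has_sum_infsum[OF sw]]
    by (rule has_sum_imp_summable)
  then have "(\<lambda>z. norm (case z of (n, t) \<Rightarrow> row_coeff q x j n * side_weight q a b t)) summable_on UNIV \<times> UNIV"
    by (rule summable_on_iff_abs_summable_on_complex[THEN iffD1])
  then have "(\<lambda>z. norm (case z of (n, t) \<Rightarrow> row_coeff q x j n * side_weight q a b t) * K) summable_on UNIV \<times> UNIV"
    by (rule summable_on_cmult_left)
  then have "(\<lambda>z. norm (T z)) summable_on UNIV \<times> UNIV"
  proof (rule Infinite_Sum.abs_summable_on_comparison_test')
    fix z :: "nat \<times> nat"
    show "norm (T z) \<le> norm (case z of (n, t) \<Rightarrow> row_coeff q x j n * side_weight q a b t) * K"
      using K by (simp add: T_def norm_mult mult_left_mono mult.assoc split: prod.split)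
  qed
  then have "T summable_on UNIV \<times> UNIV"
    by (rule summable_on_iff_abs_summable_on_complex[THEN iffD2])
  then obtain S where S: "(T has_sum S) (UNIV \<times> UNIV)"
    by (auto simp: summable_on_def)
  have row: "((\<lambda>t. T (n, t)) has_sum (P * G n)) UNIV" for n
  proof -
    have "(\<lambda>t. T (n, t)) summable_on UNIV"
      using summable_on_SigmaD1[of "curry T" UNIV "\<lambda>_. UNIV" n] S
      by (auto simp: summable_on_def curry_def)
    then have "((\<lambda>t. T (n, t)) has_sum (\<Sum>\<^sub>\<infinity>t. T (n, t))) UNIV"
      by simp
    moreover have "(\<lambda>t. T (n, t)) sums (P * G n)"
      using sums_mult[OF side_weight_bailey_kernel_sums[OF q ab nz, of n], of "row_coeff q x j n"]
      by (simp add: T_def P_def G_def mult_ac)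
    ultimately show ?thesis
      by (metis has_sum_imp_sums sums_unique2)
  qed
  have col: "((\<lambda>n. T (n, t)) has_sum (side_weight q a b t * row_gf q x j t)) UNIV" for t
  proof -
    have eq: "row_gf q x j t = (\<Sum>n\<le>t. row_coeff q x j n * bailey_kernel (q\<^sup>2) t n)"
      by (rule row_gf_eq_bailey_sum) (rule x)
    show ?thesis
      unfolding eq sum_distrib_left
      by (rule has_sum_finite_neutralI[of "{..t}"]) (auto simp: T_def bailey_kernel_def mult_ac)
  qed
  have PG: "((\<lambda>n. P * G n) has_sum S) UNIV"
    by (rule has_sum_SigmaD[OF S row])
  \<comment> \<open>The exchange of sums yields summability only of \<open>P * G n\<close>. Passing
    to \<open>G\<close> needs the infinite products in \<open>P\<close> to be nonzero, which rests
    on the hypothesis \<open>nz\<close>.\<close>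
  have "P \<noteq> 0"
  proof -
    have "qpoch1 (- c * q) (q\<^sup>2) \<infinity> \<noteq> 0" if "\<And>j. 1 + c * q ^ (2 * j + 1) \<noteq> 0" for c
      using that by (intro qfac_LIMSEQ(2) p) (simp add: mult.assoc flip: power_mult)
    then show ?thesis
      using nz qpoch1_inf_neq_0[OF p] p ab by (simp add: P_def)
  qed
  then show G: "summable G"
    using has_sum_imp_sums[OF PG] summable_mult_D[of P G] by (auto simp: sums_iff)
  have "S = P * suminf G"
    using has_sum_imp_sums[OF PG] suminf_mult[OF G, of P] by (simp add: sums_iff)
  moreover have "((\<lambda>t. side_weight q a b t * row_gf q x j t) has_sum S) UNIV"
  proof (rule has_sum_SigmaD)
    show "((\<lambda>(t, n). T (n, t)) has_sum S) (UNIV \<times> UNIV)"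
      using S by (rule has_sum_swap[THEN iffD1])
    show "((\<lambda>n. case (t, n) of (t, n) \<Rightarrow> T (n, t)) has_sum (side_weight q a b t * row_gf q x j t)) UNIV" for t
      using col by simp
  qed
  ultimately show "((\<lambda>t. side_weight q a b t * row_gf q x j t) has_sum (P * suminf G)) UNIV"
    by simp
qed

section \<open>Rows of marked symbols\<close>

text \<open>The parts are \<open>2 * l + 1\<close> with \<open>l\<close> in the half-open interval
  from \<open>L\<close> to \<open>H\<close>, so raising \<open>H\<close> by one admits exactly one
  new part.\<close>

definition odd_parts :: "nat \<Rightarrow> nat \<Rightarrow> nat list set" where
  "odd_parts L H = {ps. sorted_wrt (\<ge>) ps \<and> (\<forall>p\<in>set ps. odd p \<and> 2 * L + 1 \<le> p \<and> p < 2 * H + 1)}"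

lemma odd_parts_Suc_iff:
  "ps \<in> odd_parts M (Suc t) \<longleftrightarrow>
     sorted_wrt (\<ge>) ps \<and> (\<forall>p\<in>set ps. odd p \<and> 2 * M + 1 \<le> p \<and> p \<le> 2 * t + 1)"
proof -
  have "p < 2 * Suc t + 1 \<longleftrightarrow> p \<le> 2 * t + 1" if "odd p" for p
    using that by presburger
  then show ?thesis
    unfolding odd_parts_def by blast
qed

lemma odd_parts_empty:
  assumes "H \<le> L"
  shows "odd_parts L H = {[]}"
proof -
  have "ps = []" if "ps \<in> odd_parts L H" for ps
    using that assms by (cases ps) (auto simp: odd_parts_def)
  moreover have "[] \<in> odd_parts L H"
    by (simp add: odd_parts_def)
  ultimately show ?thesis
    by blast
qed

lemma split_largest_parts:
  assumes "sorted_wrt (\<ge>) ps" "\<forall>p\<in>set ps. p \<le> (h :: nat)"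
  shows "replicate (length (filter (\<lambda>p. p = h) ps)) h @ filter (\<lambda>p. p \<noteq> h) ps = ps"
  using assms
proof (induction ps)
  case (Cons p ps)
  show ?case
  proof (cases "p = h")
    case False
    then have "\<forall>r\<in>set ps. r \<noteq> h"
      using Cons.prems by fastforce
    then show ?thesis
      using False by (simp add: filter_empty_conv filter_id_conv)
  qed (use Cons in simp)
qed simp

lemma sorted_wrt_ge_replicate: "sorted_wrt (\<ge>) (replicate n (h :: nat))"
  by (induction n) simp_all

lemma has_sum_geometric:
  fixes z :: complex
  assumes "norm z < 1"
  shows "((\<lambda>n. z ^ n) has_sum (1 / (1 - z))) UNIV"
  using assms by (intro norm_summable_imp_has_sum geometric_sums) (simp_all add: norm_power)

text \<open>Raising \<open>H\<close> adjoins the possible part \<open>2 * H + 1\<close>. Its copies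
  form the initial block of the list, and their arbitrary number produces a geometric
  series.\<close>

lemma has_sum_odd_parts:
  fixes q x :: complex
  assumes "\<And>l. norm (x * q ^ (2 * l + 1)) < 1"
  shows "((\<lambda>ps. x ^ length ps * q ^ sum_list ps) has_sum (\<Prod>l\<in>{L..<H}. 1 / (1 - x * q ^ (2 * l + 1)))) (odd_parts L H)"
proof (induction H)
  case 0
  then show ?case
    by (simp add: odd_parts_empty has_sum_finite_iff)
next
  case (Suc H)
  show ?case
  proof (cases "Suc H \<le> L")
    case True
    then show ?thesis
      by (simp add: odd_parts_empty has_sum_finite_iff)
  next
    case False
    then have LH: "L \<le> H" by simp
    define h where "h = 2 * H + 1"
    define z where "z = x * q ^ h"
    have prod: "(\<Prod>l\<in>{L..<Suc H}. 1 / (1 - x * q ^ (2 * l + 1)))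
        = 1 / (1 - z) * (\<Prod>l\<in>{L..<H}. 1 / (1 - x * q ^ (2 * l + 1)))"
      using LH by (simp add: z_def h_def mult.commute)
    have "((\<lambda>(i, ps). z ^ i * (x ^ length ps * q ^ sum_list ps)) has_sum
        (1 / (1 - z) * (\<Prod>l\<in>{L..<H}. 1 / (1 - x * q ^ (2 * l + 1))))) (UNIV \<times> odd_parts L H)"
      by (intro has_sum_product has_sum_geometric Suc) (use assms[of H] in \<open>simp add: z_def h_def\<close>)
    also have "?this \<longleftrightarrow> ((\<lambda>ps. x ^ length ps * q ^ sum_list ps) has_sum
        (1 / (1 - z) * (\<Prod>l\<in>{L..<H}. 1 / (1 - x * q ^ (2 * l + 1))))) (odd_parts L (Suc H))"
    proof (rule has_sum_reindex_bij_witness[where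
          i = "\<lambda>ps. (length (filter (\<lambda>p. p = h) ps), filter (\<lambda>p. p \<noteq> h) ps)"
          and j = "\<lambda>(i, ps). replicate i h @ ps"])
      fix a :: "nat \<times> nat list" assume a: "a \<in> UNIV \<times> odd_parts L H"
      then obtain i ps where a': "a = (i, ps)" "ps \<in> odd_parts L H" by auto
      then have ps: "\<forall>p\<in>set ps. p < h"
        by (auto simp: odd_parts_def h_def)
      show "(\<lambda>ps. (length (filter (\<lambda>p. p = h) ps), filter (\<lambda>p. p \<noteq> h) ps)) ((\<lambda>(i, ps). replicate i h @ ps) a) = a"
        using ps by (auto simp: a' filter_empty_conv filter_id_conv)
      show "(\<lambda>(i, ps). replicate i h @ ps) a \<in> odd_parts L (Suc H)"
      proof -
        have "odd h" "2 * L + 1 \<le> h"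
          using LH by (simp_all add: h_def)
        moreover have "sorted_wrt (\<ge>) ps" "\<forall>p\<in>set ps. odd p \<and> 2 * L + 1 \<le> p \<and> p \<le> h"
          using a'(2) ps unfolding odd_parts_def by (blast intro: less_imp_le)+
        ultimately show ?thesis
          unfolding odd_parts_Suc_iff h_def[symmetric]
          by (auto simp: a' sorted_wrt_append sorted_wrt_ge_replicate)
      qed
      show "x ^ length ((\<lambda>(i, ps). replicate i h @ ps) a) * q ^ sum_list ((\<lambda>(i, ps). replicate i h @ ps) a)
          = (\<lambda>(i, ps). z ^ i * (x ^ length ps * q ^ sum_list ps)) a"
      proof -
        have "z ^ i = x ^ i * q ^ (i * h)"
          by (simp add: z_def power_mult_distrib mult.commute[of i] power_mult)
        then show ?thesis
          by (simp add: a' power_add sum_list_replicate)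
      qed
    next
      fix ps assume "ps \<in> odd_parts L (Suc H)"
      then have ps: "sorted_wrt (\<ge>) ps" "\<forall>p\<in>set ps. odd p \<and> 2 * L + 1 \<le> p \<and> p \<le> h"
        unfolding odd_parts_Suc_iff h_def by blast+
      show "(\<lambda>(i, ps). replicate i h @ ps) (length (filter (\<lambda>p. p = h) ps), filter (\<lambda>p. p \<noteq> h) ps) = ps"
        using split_largest_parts[of ps h] ps by simp
      show "(length (filter (\<lambda>p. p = h) ps), filter (\<lambda>p. p \<noteq> h) ps) \<in> UNIV \<times> odd_parts L H"
      proof -
        have "p < 2 * H + 1" if "p \<in> set ps" "p \<noteq> h" for p
          using that ps(2) h_def by (metis order.not_eq_order_implies_strict)
        then show ?thesis
          using ps by (auto simp: odd_parts_def sorted_wrt_filter)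
      qed
    qed simp
    finally show ?thesis
      unfolding prod .
  qed
qed

text \<open>Parts of one color count \<open>+1\<close> for its rank in the top row and
  \<open>-1\<close> in the bottom row; this is the origin of the two factors of
  \<open>rank_factor\<close>.\<close>

lemma has_sum_odd_parts_pair:
  assumes "rank_domain q x"
  shows "((\<lambda>(u, v). x ^ length u * q ^ sum_list u * ((1 / x) ^ length v * q ^ sum_list v)) has_sum
      (1 / (\<Prod>l\<in>{M..t}. rank_factor q x l))) (odd_parts M (Suc t) \<times> odd_parts M (Suc t))"
proof -
  have "norm (x * q ^ (2 * l + 1)) < 1" "norm (1 / x * q ^ (2 * l + 1)) < 1" for l
    using rank_domain_powers[OF assms, of l] assms by (auto simp: rank_domain_def)
  from has_sum_product[OF has_sum_odd_parts[OF this(1)] has_sum_odd_parts[OF this(2)],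
      of M "Suc t" M "Suc t"]
  show ?thesis
    by (simp add: rank_factor_def prod_dividef prod.distrib atLeastLessThanSuc_atLeastAtMost)
qed

section \<open>Colored rows and their weights\<close>

definition color :: "nat \<Rightarrow> nat list \<Rightarrow> (nat \<times> nat) list" where
  "color c ps = map (\<lambda>p. (p, c)) ps"

type_synonym row_pair = "(nat \<times> nat) list \<times> (nat \<times> nat) list"

text \<open>
  \<open>marked_rows j t\<close> uses \<open>j + 1\<close> colors. Peeling off the color \<open>j + 2\<close> together with the largest
  top row part \<open>2 * M + 1\<close> of color \<open>j + 1\<close> leaves an arbitrary pair of rows bounded by \<open>2 * M + 1\<close>.
\<close>

primrec marked_rows :: "nat \<Rightarrow> nat \<Rightarrow> row_pair set" where
  "marked_rows 0 t = (\<lambda>(u, v). (color 1 u, color 1 v)) ` (odd_parts 0 (Suc t) \<times> odd_parts 0 (Suc t))"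
| "marked_rows (Suc j) t =
     (\<lambda>(M, (u, v), (T, B)). (color (j + 2) u @ (2 * M + 1, j + 1) # T, color (j + 2) v @ B)) `
       (SIGMA M:{..t}. (odd_parts M (Suc t) \<times> odd_parts M (Suc t)) \<times> marked_rows j M)"

definition row_rank :: "nat \<Rightarrow> row_pair \<Rightarrow> nat \<Rightarrow> int" where
  "row_rank k R i = int (marks (fst R) i) - int (marks (snd R) i) - (if i < k then 1 else 0)"

definition row_weight :: "complex \<Rightarrow> (nat \<Rightarrow> complex) \<Rightarrow> nat \<Rightarrow> row_pair \<Rightarrow> complex" where
  "row_weight q x j R = (\<Prod>i = 1..j + 1. x i powi row_rank (j + 1) R i)
     * q ^ (sum_list (map fst (fst R)) + sum_list (map fst (snd R)))"

lemma marks_Nil [simp]: "marks [] i = 0"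
  and marks_Cons [simp]: "marks (e # es) i = (if snd e = i then 1 else 0) + marks es i"
  and marks_append [simp]: "marks (es @ fs) i = marks es i + marks fs i"
  by (simp_all add: marks_def)

lemma marks_color [simp]: "marks (color c ps) i = (if i = c then length ps else 0)"
  by (induction ps) (auto simp: color_def)

lemma marks_eq_0: "(\<forall>e\<in>set es. snd e \<noteq> i) \<Longrightarrow> marks es i = 0"
  by (simp add: marks_def filter_empty_conv)

lemma map_fst_color [simp]: "map fst (color c ps) = ps"
  and map_snd_color [simp]: "map snd (color c ps) = replicate (length ps) c"
  and set_color [simp]: "set (color c ps) = set ps \<times> {c}"
  by (auto simp: color_def comp_def map_replicate_const)

lemma color_inject [simp]: "color c ps = color c qs \<longleftrightarrow> ps = qs"
  by (metis map_fst_color)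

text \<open>Filtering by the color \<open>c\<close> recovers the first block, so the decomposition
  is unique.\<close>

lemma color_append_inject:
  assumes "color c u @ X = color c v @ Y" "\<forall>e\<in>set X. snd e < c" "\<forall>e\<in>set Y. snd e < c"
  shows "u = v \<and> X = Y"
proof -
  have filter: "filter (\<lambda>e. snd e = c) (color c w @ Z) = color c w"
    if "\<forall>e\<in>set Z. snd e < c" for w Z
    using that by (auto simp: filter_empty_conv filter_id_conv)
  have "color c u = color c v"
    using filter[OF assms(2), of u] filter[OF assms(3), of v] assms(1) by simp
  then show ?thesis
    using assms(1) by simp
qed

lemma marked_rows_colors:
  assumes "(T, B) \<in> marked_rows j t" "e \<in> set T \<union> set B"
  shows "1 \<le> snd e \<and> snd e \<le> j + 1"
  using assms
proof (induction j arbitrary: t T B)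
  case (Suc j)
  then obtain M u v T' B' where *: "(T', B') \<in> marked_rows j M"
    "T = color (j + 2) u @ (2 * M + 1, j + 1) # T'" "B = color (j + 2) v @ B'"
    by auto
  show ?case
    using Suc.IH[OF *(1)] Suc.prems(2) * by auto
qed auto

lemma row_weight_0:
  assumes "x 1 \<noteq> 0"
  shows "row_weight q x 0 (color 1 u, color 1 v)
    = x 1 ^ length u * q ^ sum_list u * ((1 / x 1) ^ length v * q ^ sum_list v)"
proof -
  have "x 1 powi (int (length u) - int (length v)) = x 1 ^ length u * (1 / x 1) ^ length v"
    using assms by (simp add: power_int_diff power_divide)
  then show ?thesis
    by (simp add: row_weight_def row_rank_def power_add mult_ac)
qed

text \<open>When color \<open>j + 1\<close> ceases to be the last one, its rank acquires the summand
  \<open>-1\<close>. The distinguished part \<open>2 * M + 1\<close> of that color in the top row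
  compensates for it, so the old ranks are unchanged and the part contributes only its power of
  \<open>q\<close>.\<close>

lemma row_weight_Suc:
  assumes x: "x (j + 2) \<noteq> 0" and R: "(T, B) \<in> marked_rows j M"
  shows "row_weight q x (Suc j) (color (j + 2) u @ (2 * M + 1, j + 1) # T, color (j + 2) v @ B)
    = (x (j + 2) ^ length u * q ^ sum_list u * ((1 / x (j + 2)) ^ length v * q ^ sum_list v))
        * (q ^ (2 * M + 1) * row_weight q x j (T, B))"
    (is "row_weight q x (Suc j) ?R = _")
proof -
  have "\<forall>e\<in>set T \<union> set B. snd e \<le> j + 1"
    using marked_rows_colors[OF R] by blast
  then have 0: "marks T (j + 2) = 0" "marks B (j + 2) = 0"
    by (intro marks_eq_0; force)+
  have "(\<Prod>i = 1..Suc j + 1. x i powi row_rank (Suc j + 1) ?R i)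
     = (\<Prod>i = 1..j + 1. x i powi row_rank (Suc j + 1) ?R i) * x (j + 2) powi row_rank (Suc j + 1) ?R (j + 2)"
    by simp
  also have "(\<Prod>i = 1..j + 1. x i powi row_rank (Suc j + 1) ?R i)
     = (\<Prod>i = 1..j + 1. x i powi row_rank (j + 1) (T, B) i)"
    by (intro prod.cong refl arg_cong2[where f = power_int]) (auto simp: row_rank_def)
  also have "x (j + 2) powi row_rank (Suc j + 1) ?R (j + 2) = x (j + 2) ^ length u * (1 / x (j + 2)) ^ length v"
    using x 0 by (simp add: row_rank_def power_int_diff power_divide)
  finally show ?thesis
    by (simp add: row_weight_def power_add mult_ac)
qed

lemma has_sum_Sigma_finite:
  fixes f :: "'a \<times> 'b \<Rightarrow> complex"
  assumes "finite A" "\<And>x. x \<in> A \<Longrightarrow> ((\<lambda>y. f (x, y)) has_sum g x) (B x)"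
  shows "(f has_sum sum g A) (Sigma A B)"
proof (rule has_sum_SigmaI[where g = g])
  show "(g has_sum sum g A) A"
    using assms(1) by simp
  have "(\<lambda>y. norm (f (x, y))) summable_on B x" if "x \<in> A" for x
    by (intro summable_on_iff_abs_summable_on_complex[THEN iffD1] has_sum_imp_summable[OF assms(2)[OF that]])
  then have "(\<lambda>z. norm (f z)) summable_on Sigma A B"
    by (subst Infinite_Sum.abs_summable_on_Sigma_iff) (auto intro: summable_on_finite assms(1))
  then show "f summable_on Sigma A B"
    by (rule abs_summable_summable)
qed (rule assms(2))

lemma has_sum_row_weight:
  assumes "\<And>i. i \<in> {1..j + 1} \<Longrightarrow> rank_domain q (x i)"
  shows "(row_weight q x j has_sum row_gf q x j t) (marked_rows j t)"
  using assms
proof (induction j arbitrary: t)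
  case 0
  then have x1: "rank_domain q (x 1)" by simp
  have "inj_on (\<lambda>(u, v). (color 1 u, color 1 v)) (odd_parts 0 (Suc t) \<times> odd_parts 0 (Suc t))"
    by (auto simp: inj_on_def)
  then show ?case
    using has_sum_odd_parts_pair[OF x1, of 0 t] x1
    by (simp add: has_sum_reindex comp_def case_prod_unfold row_weight_0 rank_domain_def del: One_nat_def)
next
  case (Suc j)
  define y where "y = x (j + 2)"
  have y: "rank_domain q y" "y \<noteq> 0"
    using Suc.prems[of "j + 2"] by (simp_all add: y_def rank_domain_def)
  define A where "A = (SIGMA M:{..t}. (odd_parts M (Suc t) \<times> odd_parts M (Suc t)) \<times> marked_rows j M)"
  define g :: "nat \<times> (nat list \<times> nat list) \<times> row_pair \<Rightarrow> row_pair"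
    where "g = (\<lambda>(M, (u, v), (T, B)). (color (j + 2) u @ (2 * M + 1, j + 1) # T, color (j + 2) v @ B))"
  define w where "w = (\<lambda>(u, v). y ^ length u * q ^ sum_list u * ((1 / y) ^ length v * q ^ sum_list v))"
  \<comment> \<open>The color determines the initial block of each row, and the next top row entry
    reveals \<open>M\<close>.\<close>
  have inj: "inj_on g A"
  proof (rule inj_onI)
    fix a a' assume a: "a \<in> A" "a' \<in> A" "g a = g a'"
    obtain M u v T B where e: "a = (M, (u, v), (T, B))" "(T, B) \<in> marked_rows j M"
      using a by (auto simp: A_def)
    obtain M' u' v' T' B' where e': "a' = (M', (u', v'), (T', B'))" "(T', B') \<in> marked_rows j M'"
      using a by (auto simp: A_def)
    have less: "\<forall>z\<in>set ((2 * M + 1, j + 1) # T). snd z < j + 2" "\<forall>z\<in>set B. snd z < j + 2"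
      "\<forall>z\<in>set ((2 * M' + 1, j + 1) # T'). snd z < j + 2" "\<forall>z\<in>set B'. snd z < j + 2"
      using marked_rows_colors[OF e(2)] marked_rows_colors[OF e'(2)] by (force simp: less_Suc_eq_le)+
    have "color (j + 2) u @ (2 * M + 1, j + 1) # T = color (j + 2) u' @ (2 * M' + 1, j + 1) # T'"
      "color (j + 2) v @ B = color (j + 2) v' @ B'"
      using a(3) by (simp_all add: g_def e e')
    from color_append_inject[OF this(1) less(1,3)] color_append_inject[OF this(2) less(2,4)]
    show "a = a'"
      by (simp add: e e')
  qed
  have "((\<lambda>(M, uv, R). w uv * (q ^ (2 * M + 1) * row_weight q x j R)) has_sum
      (\<Sum>M\<le>t. (1 / (\<Prod>l\<in>{M..t}. rank_factor q y l)) * (q ^ (2 * M + 1) * row_gf q x j M))) A"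
    unfolding A_def
  proof (rule has_sum_Sigma_finite)
    fix M
    have "(row_weight q x j has_sum row_gf q x j M) (marked_rows j M)"
      using Suc by simp
    then have "((\<lambda>(uv, R). w uv * (q ^ (2 * M + 1) * row_weight q x j R)) has_sum
      ((1 / (\<Prod>l\<in>{M..t}. rank_factor q y l)) * (q ^ (2 * M + 1) * row_gf q x j M)))
      ((odd_parts M (Suc t) \<times> odd_parts M (Suc t)) \<times> marked_rows j M)"
      unfolding w_def by (intro has_sum_product has_sum_cmult_right has_sum_odd_parts_pair y)
    then show "((\<lambda>z. case (M, z) of (M, uv, R) \<Rightarrow> w uv * (q ^ (2 * M + 1) * row_weight q x j R)) has_sum
      ((1 / (\<Prod>l\<in>{M..t}. rank_factor q y l)) * (q ^ (2 * M + 1) * row_gf q x j M)))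
      ((odd_parts M (Suc t) \<times> odd_parts M (Suc t)) \<times> marked_rows j M)"
      by simp
  qed simp
  also have "(\<Sum>M\<le>t. (1 / (\<Prod>l\<in>{M..t}. rank_factor q y l)) * (q ^ (2 * M + 1) * row_gf q x j M))
      = row_gf q x (Suc j) t"
    by (simp add: y_def)
  also have "((\<lambda>(M, uv, R). w uv * (q ^ (2 * M + 1) * row_weight q x j R)) has_sum row_gf q x (Suc j) t) A
      \<longleftrightarrow> ((row_weight q x (Suc j) \<circ> g) has_sum row_gf q x (Suc j) t) A"
  proof (rule has_sum_cong)
    fix a assume "a \<in> A"
    then show "(\<lambda>(M, uv, R). w uv * (q ^ (2 * M + 1) * row_weight q x j R)) a = (row_weight q x (Suc j) \<circ> g) a"
      using row_weight_Suc[of x j] y(2) by (auto simp: A_def g_def w_def y_def)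
  qed
  finally have "(row_weight q x (Suc j) has_sum row_gf q x (Suc j) t) (g ` A)"
    by (simp add: has_sum_reindex[OF inj])
  then show ?case
    by (simp add: g_def A_def)
qed

section \<open>Equivalence of the recursive description of rows with the marking conditions\<close>

definition top_max :: "(nat \<times> nat) list \<Rightarrow> nat \<Rightarrow> nat" where
  "top_max T i = Max {p. (p, i) \<in> set T}"

text \<open>The three interval conditions for subscript 1, the middle subscripts and subscript
  \<open>k = j + 1\<close> merge into a lower bound for colors from 2 on and an upper bound for
  colors up to \<open>j\<close>. The outer limits \<open>1\<close> and \<open>2 * t + 1\<close> are
  part of \<open>odd_partition\<close>. This form also makes sense for \<open>j = 0\<close>.\<close>

definition valid_rows :: "nat \<Rightarrow> nat \<Rightarrow> row_pair \<Rightarrow> bool" where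
  "valid_rows j t R \<longleftrightarrow>
     odd_partition (2 * t + 1) (map fst (fst R)) \<and> odd_partition (2 * t + 1) (map fst (snd R)) \<and>
     (\<forall>e\<in>set (fst R) \<union> set (snd R). 1 \<le> snd e \<and> snd e \<le> j + 1) \<and>
     sorted_wrt (\<ge>) (map snd (fst R)) \<and> sorted_wrt (\<ge>) (map snd (snd R)) \<and>
     (\<forall>i\<in>{1..j}. \<exists>p. (p, i) \<in> set (fst R)) \<and>
     (\<forall>e\<in>set (snd R). (2 \<le> snd e \<longrightarrow> top_max (fst R) (snd e - 1) \<le> fst e) \<and>
        (snd e \<le> j \<longrightarrow> fst e \<le> top_max (fst R) (snd e)))"

lemma split_top_color:
  assumes "sorted_wrt (\<ge>) (map snd xs)" "\<forall>e\<in>set xs. snd e \<le> c"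
  obtains u ys where "xs = color c u @ ys" "\<forall>e\<in>set ys. snd e < c"
proof -
  have "\<exists>u ys. xs = color c u @ ys \<and> (\<forall>e\<in>set ys. snd e < c)"
    using assms
  proof (induction xs)
    case Nil
    have "[] = color c [] @ []" by (simp add: color_def)
    then show ?case by fastforce
  next
    case (Cons e xs)
    obtain p d where e: "e = (p, d)" by (cases e)
    show ?case
    proof (cases "d = c")
      case True
      obtain u ys where "xs = color c u @ ys" "\<forall>e\<in>set ys. snd e < c"
        using Cons by auto
      then have "e # xs = color c (p # u) @ ys \<and> (\<forall>e\<in>set ys. snd e < c)"
        by (simp add: color_def e True)
      then show ?thesis by blast
    next
      case False
      then have "\<forall>z\<in>set (e # xs). snd z < c"
        using Cons.prems e by (fastforce simp: le_less_trans)
      then have "e # xs = color c [] @ (e # xs) \<and> (\<forall>z\<in>set (e # xs). snd z < c)"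
        by (simp add: color_def)
      then show ?thesis by blast
    qed
  qed
  then show ?thesis
    using that by blast
qed

lemma top_max_append_lower:
  assumes "i < j"
  shows "top_max (color (Suc j) u @ (p, j) # T) i = top_max T i"
proof -
  have "{r. (r, i) \<in> set (color (Suc j) u @ (p, j) # T)} = {r. (r, i) \<in> set T}"
    using assms by auto
  then show ?thesis
    by (simp add: top_max_def)
qed

lemma finite_color_parts: "finite {p. (p, i) \<in> set T}"
  by (rule finite_subset[of _ "fst ` set T"]) force+

lemma top_max_append_eq:
  assumes "\<forall>e\<in>set T. fst e \<le> p"
  shows "top_max (color (Suc j) u @ (p, j) # T) j = p"
  unfolding top_max_def
  by (rule Max_eqI[OF finite_color_parts]) (use assms in auto)

lemma top_max_in: "(p, i) \<in> set T \<Longrightarrow> (top_max T i, i) \<in> set T"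
  using Max_in[OF finite_color_parts[of i T]] by (auto simp: top_max_def)

lemma odd_partition_append:
  "odd_partition b (ps @ qs) \<longleftrightarrow>
     odd_partition b ps \<and> odd_partition b qs \<and> (\<forall>p\<in>set ps. \<forall>r\<in>set qs. r \<le> p)"
  unfolding odd_partition_def sorted_wrt_append by auto

lemma odd_partition_mono: "odd_partition b ps \<Longrightarrow> b \<le> c \<Longrightarrow> odd_partition c ps"
  unfolding odd_partition_def using le_trans by blast

text \<open>Behind the block of color \<open>j + 2\<close>, the top row continues with color
  \<open>j + 1\<close>, which must occur; as parts do not increase, this entry is the largest of its
  color. Its part \<open>2 * M + 1\<close> separates the two rows into parts of color
  \<open>j + 2\<close>, at least that large, and the rest, at most that large. In the rest,
  \<open>M\<close> takes over the role of \<open>t\<close>.\<close>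

lemma valid_rows_Suc:
  "valid_rows (Suc j) t R \<longleftrightarrow>
     (\<exists>M\<le>t. \<exists>u\<in>odd_parts M (Suc t). \<exists>v\<in>odd_parts M (Suc t). \<exists>T B. valid_rows j M (T, B) \<and>
       R = (color (j + 2) u @ (2 * M + 1, j + 1) # T, color (j + 2) v @ B))"
    (is "?lhs \<longleftrightarrow> ?rhs")
proof
  assume valid: ?lhs
  obtain T0 B0 where R: "R = (T0, B0)" by (cases R)
  have T0: "odd_partition (2 * t + 1) (map fst T0)" "sorted_wrt (\<ge>) (map snd T0)"
      "\<forall>e\<in>set T0. 1 \<le> snd e \<and> snd e \<le> j + 2" "\<forall>i\<in>{1..Suc j}. \<exists>p. (p, i) \<in> set T0"
    and B0: "odd_partition (2 * t + 1) (map fst B0)" "sorted_wrt (\<ge>) (map snd B0)"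
      "\<forall>e\<in>set B0. 1 \<le> snd e \<and> snd e \<le> j + 2"
    and low: "\<And>e. e \<in> set B0 \<Longrightarrow> 2 \<le> snd e \<Longrightarrow> top_max T0 (snd e - 1) \<le> fst e"
    and high: "\<And>e. e \<in> set B0 \<Longrightarrow> snd e \<le> Suc j \<Longrightarrow> fst e \<le> top_max T0 (snd e)"
    using valid unfolding valid_rows_def R by simp_all
  obtain u T1 where T1: "T0 = color (j + 2) u @ T1" "\<forall>e\<in>set T1. snd e < j + 2"
    using split_top_color[OF T0(2)] T0(3) by blast
  obtain v B where B: "B0 = color (j + 2) v @ B" "\<forall>e\<in>set B. snd e < j + 2"
    using split_top_color[OF B0(2)] B0(3) by blast
  obtain p0 where "(p0, j + 1) \<in> set T1"
    using T0(4) T1 by fastforce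
  then obtain p c T where T1': "T1 = (p, c) # T"
    by (cases T1) auto
  have sorted1: "sorted_wrt (\<ge>) (map snd T1)" "sorted_wrt (\<ge>) (map fst T1)"
    using T0(1,2) T1(1) by (simp_all add: odd_partition_def sorted_wrt_append)
  have c: "c = j + 1"
    using \<open>(p0, j + 1) \<in> set T1\<close> sorted1(1) T1(2) by (fastforce simp: T1')
  have T_le: "\<forall>e\<in>set T. fst e \<le> p"
    using sorted1(2) by (simp add: T1')
  have p: "odd p" "p \<le> 2 * t + 1" "\<forall>r\<in>set u. p \<le> r"
    using T0(1) by (auto simp: T1 T1' odd_partition_def sorted_wrt_append)
  then obtain M where M: "p = 2 * M + 1"
    by (auto elim: oddE)
  have T0_eq: "T0 = color (Suc (j + 1)) u @ (p, j + 1) # T"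
    using T1 T1' c by simp
  have max_p: "top_max T0 (j + 1) = p"
    unfolding T0_eq by (rule top_max_append_eq[OF T_le])
  have max_T: "top_max T0 i = top_max T i" if "i \<le> j" for i
    unfolding T0_eq using that by (intro top_max_append_lower) simp
  have ex_T: "\<exists>r. (r, i) \<in> set T" if "i \<in> {1..j}" for i
  proof -
    from that obtain r where "(r, i) \<in> set T0"
      using T0(4) by force
    then show ?thesis
      using that by (auto simp: T0_eq)
  qed
  \<comment> \<open>For a color up to \<open>j\<close> the bound passes through the top row: the
    part is at most the largest top part of its color, which lies in \<open>T\<close> and is
    therefore at most \<open>p\<close>.\<close>
  have B_le: "fst e \<le> p" if "e \<in> set B" for e
  proof -
    have e: "e \<in> set B0" "snd e \<le> Suc j" "1 \<le> snd e"
      using that B B0(3) by auto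
    show ?thesis
    proof (cases "snd e = j + 1")
      case True
      then show ?thesis
        using high[OF e(1,2)] max_p by simp
    next
      case False
      then have "snd e \<in> {1..j}"
        using e by simp
      then have "(top_max T (snd e), snd e) \<in> set T"
        using ex_T top_max_in by blast
      then have "top_max T (snd e) \<le> p"
        using T_le by force
      then show ?thesis
        using high[OF e(1,2)] max_T[of "snd e"] \<open>snd e \<in> {1..j}\<close> by simp
    qed
  qed
  have u: "u \<in> odd_parts M (Suc t)"
    using T0(1) p(3) M by (simp add: T1 odd_partition_def odd_parts_Suc_iff sorted_wrt_append)
  \<comment> \<open>The parts in \<open>u\<close> precede \<open>p\<close> in the same row, whereas
    those in \<open>v\<close> obtain their lower bound from the marking condition for color
    \<open>j + 2\<close>.\<close>
  have v: "v \<in> odd_parts M (Suc t)"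
  proof -
    have "p \<le> r" if "r \<in> set v" for r
      using low[of "(r, j + 2)"] that max_p by (simp add: B)
    then show ?thesis
      using B0(1) M by (simp add: B odd_partition_def odd_parts_Suc_iff sorted_wrt_append)
  qed
  have "valid_rows j M (T, B)"
    unfolding valid_rows_def fst_conv snd_conv
  proof (intro conjI ballI impI)
    show "odd_partition (2 * M + 1) (map fst T)"
      using T0(1) T_le by (auto simp: T0_eq odd_partition_def sorted_wrt_append M)
    show "odd_partition (2 * M + 1) (map fst B)"
      using B0(1) B_le by (auto simp: B odd_partition_def sorted_wrt_append M)
    show "sorted_wrt (\<ge>) (map snd T)"
      using T0(2) by (simp add: T0_eq sorted_wrt_append)
    show "sorted_wrt (\<ge>) (map snd B)"
      using B0(2) by (simp add: B sorted_wrt_append)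
    show "1 \<le> snd e" "snd e \<le> j + 1" if "e \<in> set T \<union> set B" for e
      using that T0(3) T1 T1' B B0(3) by (auto simp: less_Suc_eq_le)
    show "\<exists>r. (r, i) \<in> set T" if "i \<in> {1..j}" for i
      using that by (rule ex_T)
    fix e assume e: "e \<in> set B"
    then have e': "e \<in> set B0" "snd e \<le> j + 1"
      using B by (auto simp: less_Suc_eq_le)
    show "top_max T (snd e - 1) \<le> fst e" if "2 \<le> snd e"
      using low[OF e'(1) that] max_T[of "snd e - 1"] e'(2) by simp
    show "fst e \<le> top_max T (snd e)" if "snd e \<le> j"
      using high[OF e'(1)] max_T[of "snd e"] that by simp
  qed
  moreover have "M \<le> t"
    using p(2) M by simp
  moreover have "R = (color (j + 2) u @ (2 * M + 1, j + 1) # T, color (j + 2) v @ B)"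
    using R T0_eq B M by simp
  ultimately show ?rhs
    using u v by blast
next
  assume ?rhs
  then obtain M u v T B where M: "M \<le> t" and u: "u \<in> odd_parts M (Suc t)" and v: "v \<in> odd_parts M (Suc t)"
    and valid: "valid_rows j M (T, B)"
    and R: "R = (color (j + 2) u @ (2 * M + 1, j + 1) # T, color (j + 2) v @ B)"
    by blast
  define T0 where "T0 = color (Suc (j + 1)) u @ (2 * M + 1, j + 1) # T"
  have T: "odd_partition (2 * M + 1) (map fst T)" "sorted_wrt (\<ge>) (map snd T)"
      "\<forall>e\<in>set T. 1 \<le> snd e \<and> snd e \<le> j + 1" "\<forall>i\<in>{1..j}. \<exists>p. (p, i) \<in> set T"
    and B: "odd_partition (2 * M + 1) (map fst B)" "sorted_wrt (\<ge>) (map snd B)"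
      "\<forall>e\<in>set B. 1 \<le> snd e \<and> snd e \<le> j + 1"
    and low: "\<And>e. e \<in> set B \<Longrightarrow> 2 \<le> snd e \<Longrightarrow> top_max T (snd e - 1) \<le> fst e"
    and high: "\<And>e. e \<in> set B \<Longrightarrow> snd e \<le> j \<Longrightarrow> fst e \<le> top_max T (snd e)"
    using valid unfolding valid_rows_def by simp_all
  have T_le: "\<forall>e\<in>set T. fst e \<le> 2 * M + 1" and B_le: "\<forall>e\<in>set B. fst e \<le> 2 * M + 1"
    using T(1) B(1) by (auto simp: odd_partition_def)
  have max_M: "top_max T0 (j + 1) = 2 * M + 1"
    unfolding T0_def by (rule top_max_append_eq[OF T_le])
  have max_T: "top_max T0 i = top_max T i" if "i \<le> j" for i
    unfolding T0_def using that by (intro top_max_append_lower) simp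
  have uv: "sorted_wrt (\<ge>) w" "\<forall>r\<in>set w. odd r \<and> 2 * M + 1 \<le> r \<and> r \<le> 2 * t + 1"
    if "w \<in> {u, v}" for w
    using that u v unfolding odd_parts_Suc_iff by blast+
  then have op: "odd_partition (2 * t + 1) w" if "w \<in> {u, v}" for w
    using that unfolding odd_partition_def by blast
  have uv_le: "r \<le> s" if "w \<in> {u, v}" "r \<le> 2 * M + 1" "s \<in> set w" for w r s
    using uv(2)[OF that(1)] that(2,3) le_trans by blast
  have "valid_rows (Suc j) t (T0, color (j + 2) v @ B)"
    unfolding valid_rows_def fst_conv snd_conv
  proof (intro conjI ballI impI)
    show "odd_partition (2 * t + 1) (map fst T0)"
    proof -
      have "odd_partition (2 * M + 1) ((2 * M + 1) # map fst T)"
        using T(1) by (simp add: odd_partition_def)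
      then show ?thesis
        using odd_partition_mono[of "2 * M + 1" _ "2 * t + 1"] M op[of u] uv_le[of u] T_le
        by (simp add: T0_def odd_partition_append)
    qed
    show "odd_partition (2 * t + 1) (map fst (color (j + 2) v @ B))"
      using odd_partition_mono[OF B(1), of "2 * t + 1"] M op[of v] uv_le[of v] B_le
      by (simp add: odd_partition_append)
    show "sorted_wrt (\<ge>) (map snd T0)"
      using T(2,3) by (auto simp: T0_def sorted_wrt_append sorted_wrt_ge_replicate)
    show "sorted_wrt (\<ge>) (map snd (color (j + 2) v @ B))"
      using B(2,3) by (auto simp: sorted_wrt_append sorted_wrt_ge_replicate)
    show "1 \<le> snd e" "snd e \<le> Suc j + 1" if "e \<in> set T0 \<union> set (color (j + 2) v @ B)" for e
      using that T(3) B(3) by (auto simp: T0_def)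
    show "\<exists>r. (r, i) \<in> set T0" if "i \<in> {1..Suc j}" for i
      using that T(4) by (cases "i = Suc j") (auto simp: T0_def)
    fix e assume e: "e \<in> set (color (j + 2) v @ B)"
    show "top_max T0 (snd e - 1) \<le> fst e" if "2 \<le> snd e"
    proof (cases "e \<in> set B")
      case True
      then show ?thesis
        using low[OF True that] max_T[of "snd e - 1"] B(3) by fastforce
    next
      case False
      then show ?thesis
        using e uv(2)[of v] max_M by auto
    qed
    show "fst e \<le> top_max T0 (snd e)" if "snd e \<le> Suc j"
    proof -
      have "e \<in> set B"
        using e that by auto
      show ?thesis
      proof (cases "snd e \<le> j")
        case True
        then show ?thesis
          using high[OF \<open>e \<in> set B\<close>] max_T by simp
      next
        \<comment> \<open>Color \<open>j + 1\<close> was the last color of \<open>(T, B)\<close> and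
          was limited only by \<open>2 * M + 1\<close>; this limit is now the largest top row part
          of that color.\<close>
        case False
        then have "snd e = j + 1"
          using that by simp
        then show ?thesis
          using max_M B_le \<open>e \<in> set B\<close> by simp
      qed
    qed
  qed
  then show ?lhs
    by (simp add: R T0_def)
qed

lemma valid_rows_0: "valid_rows 0 t R \<longleftrightarrow> R \<in> marked_rows 0 t"
proof
  have color_map: "T = color 1 (map fst T)" if "\<forall>e\<in>set T. snd e = 1" for T
    using that by (induction T) (auto simp: color_def)
  assume valid: "valid_rows 0 t R"
  then have "\<forall>e\<in>set (fst R). snd e = 1" "\<forall>e\<in>set (snd R). snd e = 1"
    by (auto simp: valid_rows_def intro: le_antisym)
  then have "R = (color 1 (map fst (fst R)), color 1 (map fst (snd R)))"
    using color_map by (simp add: prod_eq_iff)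
  moreover have "ps \<in> odd_parts 0 (Suc t)" if "odd_partition (2 * t + 1) ps" for ps
    using that unfolding odd_partition_def odd_parts_Suc_iff by (auto simp: odd_pos Suc_leI)
  then have "map fst (fst R) \<in> odd_parts 0 (Suc t)" "map fst (snd R) \<in> odd_parts 0 (Suc t)"
    using valid unfolding valid_rows_def by blast+
  ultimately show "R \<in> marked_rows 0 t"
    unfolding marked_rows.simps by (metis (no_types, lifting) image_eqI mem_Sigma_iff case_prod_conv)
next
  assume "R \<in> marked_rows 0 t"
  then obtain u v where R: "R = (color 1 u, color 1 v)" "u \<in> odd_parts 0 (Suc t)" "v \<in> odd_parts 0 (Suc t)"
    by auto
  then have "odd_partition (2 * t + 1) u" "odd_partition (2 * t + 1) v"
    unfolding odd_parts_Suc_iff odd_partition_def by blast+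
  then show "valid_rows 0 t R"
    by (auto simp: R(1) valid_rows_def sorted_wrt_ge_replicate)
qed

lemma marked_rows_iff_valid: "R \<in> marked_rows j t \<longleftrightarrow> valid_rows j t R"
proof (induction j arbitrary: t R)
  case 0
  show ?case
    by (simp only: valid_rows_0)
next
  case (Suc j)
  show ?case
    unfolding valid_rows_Suc Suc[symmetric]
  proof
    assume "R \<in> marked_rows (Suc j) t"
    then obtain a where a: "a \<in> (SIGMA M:{..t}. (odd_parts M (Suc t) \<times> odd_parts M (Suc t)) \<times> marked_rows j M)"
      "R = (\<lambda>(M, (u, v), (T, B)). (color (j + 2) u @ (2 * M + 1, j + 1) # T, color (j + 2) v @ B)) a"
      unfolding marked_rows.simps by blast
    obtain M u v T B where a': "a = (M, (u, v), (T, B))"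
      by (metis prod.exhaust)
    have "M \<le> t" "u \<in> odd_parts M (Suc t)" "v \<in> odd_parts M (Suc t)" "(T, B) \<in> marked_rows j M"
      "R = (color (j + 2) u @ (2 * M + 1, j + 1) # T, color (j + 2) v @ B)"
      using a unfolding a' by simp_all
    then show "\<exists>M\<le>t. \<exists>u\<in>odd_parts M (Suc t). \<exists>v\<in>odd_parts M (Suc t). \<exists>T B.
        (T, B) \<in> marked_rows j M \<and> R = (color (j + 2) u @ (2 * M + 1, j + 1) # T, color (j + 2) v @ B)"
      by blast
  next
    assume "\<exists>M\<le>t. \<exists>u\<in>odd_parts M (Suc t). \<exists>v\<in>odd_parts M (Suc t). \<exists>T B.
        (T, B) \<in> marked_rows j M \<and> R = (color (j + 2) u @ (2 * M + 1, j + 1) # T, color (j + 2) v @ B)"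
    then obtain M u v T B where *: "M \<le> t" "u \<in> odd_parts M (Suc t)" "v \<in> odd_parts M (Suc t)"
      "(T, B) \<in> marked_rows j M" "R = (color (j + 2) u @ (2 * M + 1, j + 1) # T, color (j + 2) v @ B)"
      by blast
    show "R \<in> marked_rows (Suc j) t"
      unfolding marked_rows.simps by (rule image_eqI[of _ _ "(M, (u, v), (T, B))"]) (use * in simp_all)
  qed
qed

section \<open>Counting symbols\<close>

definition distinct_odd :: "nat \<Rightarrow> nat list set" where
  "distinct_odd t = {ps. odd_partition (2 * t - 1) ps \<and> distinct ps}"

lemma distinct_odd_0: "distinct_odd 0 = {[]}"
proof -
  have "ps = []" if "ps \<in> distinct_odd 0" for ps
    using that by (cases ps) (auto simp: distinct_odd_def odd_partition_def)
  moreover have "[] \<in> distinct_odd 0"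
    by (simp add: distinct_odd_def odd_partition_def)
  ultimately show ?thesis
    by blast
qed

text \<open>The new part \<open>2 * t + 1\<close> exceeds all others, so it is either absent or the
  head, and distinctness forbids a second copy.\<close>

lemma distinct_odd_Suc: "distinct_odd (Suc t) = distinct_odd t \<union> (#) (2 * t + 1) ` distinct_odd t"
proof -
  \<comment> \<open>For \<open>t = 0\<close> the truncated bound \<open>2 * t - 1\<close> is
    \<open>0\<close>, which no odd number meets.\<close>
  have bound: "odd p \<Longrightarrow> p \<le> 2 * Suc t - 1 \<longleftrightarrow> p = 2 * t + 1 \<or> p \<le> 2 * t - 1" for p :: nat
    by presburger
  have top: "\<not> 2 * t + 1 \<le> 2 * t - 1"
    by simp
  have "ps \<in> distinct_odd (Suc t) \<longleftrightarrow> ps \<in> distinct_odd t \<or> ps \<in> (#) (2 * t + 1) ` distinct_odd t" for ps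
  proof (cases "2 * t + 1 \<in> set ps")
    case True
    then obtain p qs where ps: "ps = p # qs"
      by (cases ps) auto
    show ?thesis
    proof
      assume "ps \<in> distinct_odd (Suc t)"
      then have *: "sorted_wrt (\<ge>) (p # qs)" "\<forall>r\<in>set (p # qs). odd r \<and> r \<le> 2 * Suc t - 1" "distinct (p # qs)"
        by (simp_all add: distinct_odd_def odd_partition_def ps)
      have "2 * t + 1 \<le> p"
        using True *(1) by (auto simp: ps)
      moreover have "p \<le> 2 * t + 1"
        using *(2) by simp
      ultimately have p: "p = 2 * t + 1"
        by simp
      have "odd r \<and> r \<le> 2 * t - 1" if "r \<in> set qs" for r
        using that *(2,3) bound[of r] p by auto
      then have "qs \<in> distinct_odd t"
        using * by (simp add: distinct_odd_def odd_partition_def)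
      then show "ps \<in> distinct_odd t \<or> ps \<in> (#) (2 * t + 1) ` distinct_odd t"
        by (simp add: ps p)
    next
      assume "ps \<in> distinct_odd t \<or> ps \<in> (#) (2 * t + 1) ` distinct_odd t"
      moreover have "ps \<notin> distinct_odd t"
        using True top by (auto simp: distinct_odd_def odd_partition_def)
      ultimately have "p = 2 * t + 1" and qs: "qs \<in> distinct_odd t"
        by (auto simp: ps)
      moreover have "r \<le> 2 * t + 1 \<and> r \<noteq> 2 * t + 1" if "r \<in> set qs" for r
      proof -
        have "r \<le> 2 * t - 1"
          using that qs by (simp add: distinct_odd_def odd_partition_def)
        then show ?thesis by linarith
      qed
      ultimately show "ps \<in> distinct_odd (Suc t)"
        using qs by (auto simp: ps distinct_odd_def odd_partition_def)
    qed
  next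
    case False
    then have "(\<forall>p\<in>set ps. odd p \<and> p \<le> 2 * Suc t - 1) \<longleftrightarrow> (\<forall>p\<in>set ps. odd p \<and> p \<le> 2 * t - 1)"
      using bound by metis
    then show ?thesis
      using False unfolding distinct_odd_def odd_partition_def by auto
  qed
  then show ?thesis
    by blast
qed

lemma finite_missing: "finite (missing t ps)"
proof -
  have "missing t ps \<subseteq> (\<lambda>x. 2 * x - 1) ` {1..t}"
    by (auto simp: missing_def)
  then show ?thesis
    by (rule finite_subset) simp
qed

lemma missing_Suc: "missing (Suc t) ps = (if 2 * t + 1 \<in> set ps then missing t ps else insert (2 * t + 1) (missing t ps))"
proof -
  have "r \<in> missing (Suc t) ps \<longleftrightarrow> r \<in> missing t ps \<or> r = 2 * t + 1 \<and> 2 * t + 1 \<notin> set ps" for r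
  proof -
    have "(\<exists>x. r = 2 * x - 1 \<and> 1 \<le> x \<and> x \<le> Suc t \<and> 2 * x - 1 \<notin> set ps)
      \<longleftrightarrow> (\<exists>x. r = 2 * x - 1 \<and> 1 \<le> x \<and> x \<le> t \<and> 2 * x - 1 \<notin> set ps) \<or> r = 2 * t + 1 \<and> 2 * t + 1 \<notin> set ps"
      by (auto simp: le_Suc_eq intro: exI[of _ "Suc t"])
    then show ?thesis
      by (simp add: missing_def)
  qed
  then show ?thesis
    by auto
qed

lemma missing_Cons: "missing t ((2 * t + 1) # ps) = missing t ps"
proof -
  have "2 * x - 1 \<noteq> 2 * t + 1" if "x \<le> t" for x
    using that by linarith
  then show ?thesis
    unfolding missing_def by (auto simp del: One_nat_def)
qed

text \<open>Omitting \<open>2 * t + 1\<close> creates one more missing number, prepending it creates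
  none. Finiteness is carried along because the step splits the sum over a disjoint union.\<close>

lemma sum_distinct_odd:
  "finite (distinct_odd t) \<and>
   (\<Sum>ps\<in>distinct_odd t. a ^ card (missing t ps) * q ^ sum_list ps) = (\<Prod>j<t. a + q ^ (2 * j + 1 :: nat) :: complex)"
proof (induction t)
  case 0
  have "missing 0 [] = {}"
    by (simp add: missing_def)
  then show ?case
    by (simp add: distinct_odd_0)
next
  case (Suc t)
  let ?h = "2 * t + 1"
  have not_in: "?h \<notin> set ps" if "ps \<in> distinct_odd t" for ps
  proof
    assume "?h \<in> set ps"
    with that have "?h \<le> 2 * t - 1"
      unfolding distinct_odd_def odd_partition_def by blast
    then show False by simp
  qed
  have "?h \<notin> missing t ps" for ps
    by (auto simp: missing_def)
  then have card1: "card (missing (Suc t) ps) = Suc (card (missing t ps))" if "ps \<in> distinct_odd t" for ps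
    using not_in[OF that] by (simp add: missing_Suc finite_missing)
  have card2: "missing (Suc t) (?h # ps) = missing t ps" for ps
    using missing_Cons[of t ps] by (simp add: missing_Suc)
  have disj: "distinct_odd t \<inter> (#) ?h ` distinct_odd t = {}"
    using not_in by fastforce
  have fin: "finite (distinct_odd t)"
    using Suc by simp
  have "(\<Sum>ps\<in>distinct_odd (Suc t). a ^ card (missing (Suc t) ps) * q ^ sum_list ps)
      = (\<Sum>ps\<in>distinct_odd t. a ^ card (missing (Suc t) ps) * q ^ sum_list ps)
        + (\<Sum>ps\<in>distinct_odd t. a ^ card (missing (Suc t) (?h # ps)) * q ^ sum_list (?h # ps))"
    unfolding distinct_odd_Suc
    by (subst sum.union_disjoint) (use fin disj in \<open>simp_all add: sum.reindex\<close>)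
  also have "\<dots> = (\<Sum>ps\<in>distinct_odd t. a ^ card (missing t ps) * q ^ sum_list ps) * (a + q ^ ?h)"
    unfolding card2 by (simp add: card1 power_add sum_distrib_left sum_distrib_right distrib_left sum.distrib mult_ac
        cong: sum.cong)
  finally show ?case
    using Suc by (simp add: distinct_odd_Suc)
qed

section \<open>Marked symbols and their weights\<close>

definition symbol_size :: "(nat \<times> nat) durfee_array \<Rightarrow> nat" where
  "symbol_size d = sum_list (map fst (top_row d)) + sum_list (map fst (bottom_row d))
     + sum_list (lam d) + sum_list (mu d) + 2 * side d + 1"

definition make_symbol :: "nat \<times> (nat list \<times> nat list) \<times> row_pair \<Rightarrow> (nat \<times> nat) durfee_array" where
  "make_symbol = (\<lambda>(t, (l, m), (T, B)). Durfee_Array T B l m t)"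

text \<open>The nesting mirrors the summation: \<open>t\<close> outermost, and for fixed
  \<open>t\<close> a product whose factors are summed separately.\<close>

definition symbol_data :: "nat \<Rightarrow> (nat \<times> (nat list \<times> nat list) \<times> row_pair) set" where
  "symbol_data j = (SIGMA t:UNIV. (distinct_odd t \<times> distinct_odd t) \<times> marked_rows j t)"

text \<open>Once the parts are odd and bounded, the marking conditions are those of
  \<open>valid_rows\<close>. The assumption \<open>j \<ge> 1\<close> keeps the extreme subscripts
  apart: with a single color, the clauses for subscript 1 and for subscript \<open>k\<close> would
  constrain the same entries.\<close>

lemma marked_symbol_iff:
  assumes "j \<ge> 1"
  shows "marked_gen_odd_durfee_symbol (Suc j) d n \<longleftrightarrow> d \<in> make_symbol ` symbol_data j \<and> n = symbol_size d"
proof -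
  obtain T B l m t where d: "d = Durfee_Array T B l m t"
    by (cases d)
  have max: "largest_top (Durfee_Array T B l m t) i = top_max T i" for i
    by (simp add: largest_top_def top_max_def)
  \<comment> \<open>Oddness gives the lower limit 1 and the row bound gives the upper limit
    \<open>2 * t + 1\<close>, so only the comparisons with \<open>top_max\<close> remain.\<close>
  have bottom: "(\<forall>(p, c)\<in>set B.
        (c = 1 \<longrightarrow> p \<in> {1..top_max T 1}) \<and>
        (2 \<le> c \<and> c \<le> Suc j - 1 \<longrightarrow> p \<in> {top_max T (c - 1)..top_max T c}) \<and>
        (c = Suc j \<longrightarrow> p \<in> {top_max T (Suc j - 1)..2 * t + 1}))
    \<longleftrightarrow> (\<forall>e\<in>set B. (2 \<le> snd e \<longrightarrow> top_max T (snd e - 1) \<le> fst e) \<and> (snd e \<le> j \<longrightarrow> fst e \<le> top_max T (snd e)))"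
    if B: "odd_partition (2 * t + 1) (map fst B)" "\<forall>e\<in>set T \<union> set B. 1 \<le> snd e \<and> snd e \<le> j + 1"
  proof (rule ball_cong[OF refl])
    fix e assume e: "e \<in> set B"
    obtain p c where e': "e = (p, c)" by (cases e)
    have "1 \<le> p" "p \<le> 2 * t + 1"
      using B(1) e e' by (auto simp: odd_partition_def odd_pos Suc_leI)
    moreover have "1 \<le> snd e \<and> snd e \<le> j + 1"
      using B(2) e by blast
    then have "c = 1 \<or> 2 \<le> c \<and> c \<le> j \<or> c = Suc j" "1 \<le> c"
      by (auto simp: e')
    ultimately show "(case e of (p, c) \<Rightarrow>
        (c = 1 \<longrightarrow> p \<in> {1..top_max T 1}) \<and>
        (2 \<le> c \<and> c \<le> Suc j - 1 \<longrightarrow> p \<in> {top_max T (c - 1)..top_max T c}) \<and>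
        (c = Suc j \<longrightarrow> p \<in> {top_max T (Suc j - 1)..2 * t + 1}))
      \<longleftrightarrow> (2 \<le> snd e \<longrightarrow> top_max T (snd e - 1) \<le> fst e) \<and> (snd e \<le> j \<longrightarrow> fst e \<le> top_max T (snd e))"
      using assms by (auto simp: e')
  qed
  have "marked_gen_odd_durfee_symbol (Suc j) d n
      \<longleftrightarrow> valid_rows j t (T, B) \<and> l \<in> distinct_odd t \<and> m \<in> distinct_odd t \<and> n = symbol_size d"
  proof -
    have "(\<forall>(p, c)\<in>set T \<union> set B. c \<in> {1..Suc j}) \<longleftrightarrow> (\<forall>e\<in>set T \<union> set B. 1 \<le> snd e \<and> snd e \<le> j + 1)"
      by (auto simp: case_prod_unfold)
    moreover have "n = symbol_size d \<Longrightarrow> n > 0"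
      by (simp add: symbol_size_def)
    ultimately show ?thesis
      using bottom[unfolded diff_Suc_1]
      unfolding marked_gen_odd_durfee_symbol_def gen_odd_durfee_symbol_def max valid_rows_def
        distinct_odd_def mem_Collect_eq symbol_size_def fst_conv snd_conv d
        durfee_array.map durfee_array.sel diff_Suc_1
      by argo
  qed
  also have "\<dots> \<longleftrightarrow> d \<in> make_symbol ` symbol_data j \<and> n = symbol_size d"
    unfolding marked_rows_iff_valid[symmetric] d make_symbol_def symbol_data_def
    by (auto simp: image_iff Bex_def split: prod.split)
  finally show ?thesis .
qed

definition symbol_weight ::
    "complex \<Rightarrow> complex \<Rightarrow> complex \<Rightarrow> (nat \<Rightarrow> complex) \<Rightarrow> nat \<Rightarrow> (nat \<times> nat) durfee_array \<Rightarrow> complex" where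
  "symbol_weight q a b x j d = (\<Prod>i = 1..j + 1. x i powi rank_at (j + 1) d i)
     * a ^ card (missing (side d) (lam d)) * b ^ card (missing (side d) (mu d)) * q ^ symbol_size d"

lemma symbol_weight_make_symbol:
  "symbol_weight q a b x j (make_symbol (t, (l, m), R)) = q ^ (2 * t + 1) *
     ((a ^ card (missing t l) * q ^ sum_list l) * (b ^ card (missing t m) * q ^ sum_list m) * row_weight q x j R)"
proof -
  obtain T B where R: "R = (T, B)" by (cases R)
  show ?thesis
    by (simp add: symbol_weight_def make_symbol_def R row_weight_def rank_at_def row_rank_def symbol_size_def
        power_add mult_ac)
qed

lemma has_sum_symbol_level:
  assumes "\<And>i. i \<in> {1..j + 1} \<Longrightarrow> rank_domain q (x i)"
  shows "((\<lambda>z. symbol_weight q a b x j (make_symbol (t, z))) has_sum (side_weight q a b t * row_gf q x j t))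
      ((distinct_odd t \<times> distinct_odd t) \<times> marked_rows j t)"
proof -
  have part: "((\<lambda>l. c ^ card (missing t l) * q ^ sum_list l) has_sum (\<Prod>j<t. c + q ^ (2 * j + 1))) (distinct_odd t)" for c
    using sum_distinct_odd[of t c q] by (intro has_sum_finiteI) simp_all
  have rows: "(row_weight q x j has_sum row_gf q x j t) (marked_rows j t)"
    by (rule has_sum_row_weight) (rule assms)
  have "((\<lambda>z. q ^ (2 * t + 1) * (case z of (lm, R) \<Rightarrow>
      (case lm of (l, m) \<Rightarrow> (a ^ card (missing t l) * q ^ sum_list l) * (b ^ card (missing t m) * q ^ sum_list m))
        * row_weight q x j R)) has_sum
     (q ^ (2 * t + 1) * (((\<Prod>j<t. a + q ^ (2 * j + 1)) * (\<Prod>j<t. b + q ^ (2 * j + 1))) * row_gf q x j t)))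
      ((distinct_odd t \<times> distinct_odd t) \<times> marked_rows j t)"
    by (intro has_sum_cmult_right has_sum_product part rows)
  moreover have "q ^ (2 * t + 1) * (case z of (lm, R) \<Rightarrow>
      (case lm of (l, m) \<Rightarrow> (a ^ card (missing t l) * q ^ sum_list l) * (b ^ card (missing t m) * q ^ sum_list m))
        * row_weight q x j R) = symbol_weight q a b x j (make_symbol (t, z))" for z
    by (cases z rule: prod.exhaust, cases "fst z") (simp add: symbol_weight_make_symbol)
  ultimately show ?thesis
    by (simp add: side_weight_def prod.distrib mult_ac)
qed

lemma of_real_norm_symbol_weight:
  "of_real (norm (symbol_weight q a b x j d))
    = symbol_weight (of_real (norm q)) (of_real (norm a)) (of_real (norm b)) (\<lambda>i. of_real (norm (x i))) j d"
  by (simp add: symbol_weight_def norm_mult norm_power norm_power_int flip: prod_norm)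

lemma rank_domain_norm: "rank_domain q x \<Longrightarrow> rank_domain (of_real (norm q)) (of_real (norm x))"
  by (simp add: rank_domain_def norm_mult norm_divide)

text \<open>
  The absolute values of the weights are the weights at the absolute values of the variables, so the
  formula for \<open>row_gf\<close> itself bounds their sums.
\<close>

lemma summable_symbol_weight:
  assumes q: "norm q < 1" and ab: "norm (a * b * q\<^sup>2) < 1"
    and x: "\<And>i. i \<in> {1..j + 1} \<Longrightarrow> rank_domain q (x i)"
  shows "(\<lambda>z. symbol_weight q a b x j (make_symbol z)) summable_on symbol_data j"
proof -
  define q' a' b' :: complex where "q' = of_real (norm q)" and "a' = of_real (norm a)" and "b' = of_real (norm b)"
  define x' :: "nat \<Rightarrow> complex" where "x' i = of_real (norm (x i))" for i
  define C where "C t = side_weight q' a' b' t * row_gf q' x' j t" for t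
  have q': "norm q' < 1"
    using q by (simp add: q'_def)
  have ab': "norm (a' * b' * q'\<^sup>2) < 1"
    using ab by (simp add: q'_def a'_def b'_def norm_mult norm_power)
  have x': "rank_domain q' (x' i)" if "i \<in> {1..j + 1}" for i
    using rank_domain_norm[OF x[OF that]] by (simp add: q'_def x'_def)
  \<comment> \<open>The level formula yields a complex value \<open>C t\<close>. Being a sum of
    nonnegative reals, it equals its own norm.\<close>
  have level: "((\<lambda>z. norm (symbol_weight q a b x j (make_symbol (t, z)))) has_sum norm (C t))
      ((distinct_odd t \<times> distinct_odd t) \<times> marked_rows j t)" (is "(?f has_sum _) ?A") for t
  proof -
    have sum: "((\<lambda>z. complex_of_real (?f z)) has_sum C t) ?A"
      unfolding of_real_norm_symbol_weight C_def q'_def[symmetric] a'_def[symmetric] b'_def[symmetric] x'_def[symmetric]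
      by (rule has_sum_symbol_level) (rule x')
    then have "(\<lambda>z. norm (complex_of_real (?f z))) summable_on ?A"
      by (intro summable_on_iff_abs_summable_on_complex[THEN iffD1] has_sum_imp_summable)
    then obtain s where s: "(?f has_sum s) ?A"
      by (auto simp: summable_on_def)
    then have "((\<lambda>z. complex_of_real (?f z)) has_sum complex_of_real s) ?A"
      by (rule has_sum_of_real)
    then have "C t = complex_of_real s"
      using sum has_sum_unique by blast
    moreover have "s \<ge> 0"
      using s by (rule has_sum_nonneg) simp
    ultimately show ?thesis
      using s by simp
  qed
  obtain K where K: "\<And>t. norm (row_gf q' x' j t) \<le> K"
    using row_gf_bounded[OF q'] x' by blast
  have "summable (\<lambda>t. norm (side_weight q' a' b' t) * K)"
    by (intro summable_mult2 summable_side_weight q' ab')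
  then have "summable (\<lambda>t. norm (C t))"
    by (rule summable_comparison_test'[where N = 0]) (simp add: C_def norm_mult mult_left_mono K)
  then have C: "(\<lambda>t. norm (C t)) summable_on UNIV"
    by (simp add: summable_on_UNIV_nonneg_real_iff)
  have "(\<lambda>z. norm (symbol_weight q a b x j (make_symbol z))) summable_on symbol_data j"
    unfolding symbol_data_def
  proof (rule Infinite_Sum.abs_summable_on_Sigma_iff[THEN iffD2, OF conjI])
    show "\<forall>t\<in>UNIV. (\<lambda>z. norm (symbol_weight q a b x j (make_symbol (t, z)))) summable_on
        ((distinct_odd t \<times> distinct_odd t) \<times> marked_rows j t)"
      using level by (auto simp: summable_on_def)
    have "infsum (\<lambda>z. norm (symbol_weight q a b x j (make_symbol (t, z))))
        ((distinct_odd t \<times> distinct_odd t) \<times> marked_rows j t) = norm (C t)" for t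
      using level by (rule infsumI)
    then show "(\<lambda>t. norm (infsum (\<lambda>z. norm (symbol_weight q a b x j (make_symbol (t, z))))
        ((distinct_odd t \<times> distinct_odd t) \<times> marked_rows j t))) summable_on UNIV"
      using C by simp
  qed
  then show ?thesis
    by (rule abs_summable_summable)
qed

lemma has_sum_symbols:
  assumes q: "norm q < 1" and ab: "norm (a * b * q\<^sup>2) < 1"
    and x: "\<And>i. i \<in> {1..j + 1} \<Longrightarrow> rank_domain q (x i)"
    and S: "((\<lambda>t. side_weight q a b t * row_gf q x j t) has_sum S) UNIV"
  shows "(symbol_weight q a b x j has_sum S) (make_symbol ` symbol_data j)"
proof -
  have "inj_on make_symbol (symbol_data j)"
    by (auto simp: inj_on_def make_symbol_def)
  moreover have "((\<lambda>z. symbol_weight q a b x j (make_symbol z)) has_sum S) (symbol_data j)"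
    unfolding symbol_data_def
  proof (rule has_sum_SigmaI[OF _ S])
    show "((\<lambda>z. symbol_weight q a b x j (make_symbol (t, z))) has_sum (side_weight q a b t * row_gf q x j t))
      ((distinct_odd t \<times> distinct_odd t) \<times> marked_rows j t)" for t
      by (rule has_sum_symbol_level) (rule x)
    show "(\<lambda>z. symbol_weight q a b x j (make_symbol z)) summable_on
        (SIGMA t:UNIV. (distinct_odd t \<times> distinct_odd t) \<times> marked_rows j t)"
      unfolding symbol_data_def[symmetric] by (rule summable_symbol_weight[OF q ab]) (rule x)
  qed
  ultimately show ?thesis
    by (simp add: has_sum_reindex comp_def)
qed

text \<open>\<open>num_symbols\<close> is a cardinality, which would be \<open>0\<close> for an
  infinite set. Odd parts are at least 1, so the size \<open>n\<close> bounds all parts and all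
  lengths.\<close>

lemma finite_marked_symbols: "finite {d. marked_gen_odd_durfee_symbol k d n}"
proof -
  define P where "P = {es. set es \<subseteq> {..n} \<times> {..k} \<and> length es \<le> n}"
  define Q where "Q = {ps. set ps \<subseteq> {..n} \<and> length ps \<le> n}"
  have len: "length ps \<le> sum_list ps \<and> set ps \<subseteq> {..sum_list ps}" if "\<forall>p\<in>set ps. odd p" for ps :: "nat list"
    using that
  proof (induction ps)
    case (Cons p ps)
    then have "p \<ge> 1"
      by (simp add: odd_pos Suc_leI)
    then show ?case
      using Cons by fastforce
  qed simp
  have "finite (P \<times> P \<times> Q \<times> Q \<times> {..n})"
    by (simp add: P_def Q_def finite_lists_length_le)
  moreover have "{d. marked_gen_odd_durfee_symbol k d n} \<subseteq> (\<lambda>(T, B, l, m, t). Durfee_Array T B l m t) ` (P \<times> P \<times> Q \<times> Q \<times> {..n})"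
  proof
    fix d assume "d \<in> {d. marked_gen_odd_durfee_symbol k d n}"
    then have marked: "marked_gen_odd_durfee_symbol k d n" by simp
    obtain T B l m t where d: "d = Durfee_Array T B l m t"
      by (cases d)
    have odd: "\<forall>p\<in>set (map fst T). odd p" "\<forall>p\<in>set (map fst B). odd p" "\<forall>p\<in>set l. odd p" "\<forall>p\<in>set m. odd p"
      and n: "n = sum_list (map fst T) + sum_list (map fst B) + sum_list l + sum_list m + 2 * t + 1"
      and col: "\<forall>e\<in>set T \<union> set B. snd e \<le> k"
      using marked unfolding marked_gen_odd_durfee_symbol_def gen_odd_durfee_symbol_def odd_partition_def d
        durfee_array.map durfee_array.sel by fastforce+
    have P: "es \<in> P" if "\<forall>p\<in>set (map fst es). odd p" "sum_list (map fst es) \<le> n" "\<forall>e\<in>set es. snd e \<le> k" for es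
    proof -
      have "fst e \<le> n" if "e \<in> set es" for e
      proof -
        have "fst e \<in> set (map fst es)"
          using that by simp
        then have "fst e \<le> sum_list (map fst es)"
          using len[OF \<open>\<forall>p\<in>set (map fst es). odd p\<close>] by blast
        then show ?thesis
          using \<open>sum_list (map fst es) \<le> n\<close> by simp
      qed
      moreover have "length es \<le> n"
        using len[OF that(1)] that(2) by simp
      ultimately show ?thesis
        using that(3) by (auto simp: P_def)
    qed
    have Q: "ps \<in> Q" if "\<forall>p\<in>set ps. odd p" "sum_list ps \<le> n" for ps
      using len[OF that(1)] that(2) unfolding Q_def by (auto intro: order.trans)
    have "T \<in> P" "B \<in> P" "l \<in> Q" "m \<in> Q"
      using col n by (intro P Q odd; simp)+
    moreover have "t \<le> n"
      using n by simp
    ultimately show "d \<in> (\<lambda>(T, B, l, m, t). Durfee_Array T B l m t) ` (P \<times> P \<times> Q \<times> Q \<times> {..n})"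
      by (intro image_eqI[of _ _ "(T, B, l, m, t)"]) (simp_all add: d)
  qed
  ultimately show ?thesis
    by (rule finite_surj)
qed

text \<open>The multiple series is taken as one unconditional sum over all exponents. Rank vectors
  are extensional functions on \<open>{1..k}\<close>, so that each tuple of ranks is counted
  once.\<close>

theorem theorem2p3:
  fixes k :: nat and q a b :: complex and x :: "nat \<Rightarrow> complex"
  assumes "k \<ge> 2"
    and "norm q < 1"
    and "a \<noteq> 0" and "b \<noteq> 0"
    and "\<And>i. i \<in> {1..k} \<Longrightarrow> x i \<noteq> 0 \<and> norm (x i * q) < 1 \<and> norm (q / x i) < 1"
    and "norm (a * b * q ^ 2) < 1"
    and "\<And>j :: nat. 1 + a * q ^ (2 * j + 1) \<noteq> 0 \<and> 1 + b * q ^ (2 * j + 1) \<noteq> 0"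
  shows "let F = (\<lambda>n :: nat.
      (1 - q ^ (4 * n + 2)) * qpoch [- q / a, - q / b] (q ^ 2) (enat n) * (- a * b) ^ n
        * q ^ (n ^ 2 + (2 * k + 1) * n + k)
      / (qpoch [- a * q, - b * q] (q ^ 2) (enat (n + 1))
          * (\<Prod>i = 1..k. (1 - x i * q ^ (2 * n + 1)) * (1 - q ^ (2 * n + 1) / x i))))
    in summable F \<and>
    ((\<lambda>(m, r, s, n). of_nat (num_symbols k r s m n)
         * (\<Prod>i = 1..k. x i powi m i) * a ^ r * b ^ s * q ^ n)
      has_sum
      qpoch [- a * q, - b * q] (q ^ 2) \<infinity> / qpoch [q ^ 2, a * b * q ^ 2] (q ^ 2) \<infinity>
        * (\<Sum>n. F n))
      (({1..k} \<rightarrow>\<^sub>E (UNIV :: int set)) \<times> (UNIV :: nat set) \<times> (UNIV :: nat set) \<times> (UNIV :: nat set))"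
proof -
  define j where "j = k - 1"
  have k: "k = Suc j" "k = j + 1" and j: "j \<ge> 1"
    using assms(1) by (simp_all add: j_def)
  have x: "rank_domain q (x i)" if "i \<in> {1..j + 1}" for i
    using assms(2,5) that by (simp add: rank_domain_def k)
  have fin: "qpoch [c, d] p (enat n) = qfac c p n * qfac d p n"
    and inf: "qpoch [c, d] p \<infinity> = qpoch1 c p \<infinity> * qpoch1 d p \<infinity>" for c d p n
    by (simp_all add: qpoch_def qpoch1_def qfac_def)
  define F where "F n = (1 - q ^ (4 * n + 2)) * qpoch [- q / a, - q / b] (q ^ 2) (enat n) * (- a * b) ^ n
        * q ^ (n ^ 2 + (2 * k + 1) * n + k)
      / (qpoch [- a * q, - b * q] (q ^ 2) (enat (n + 1))
          * (\<Prod>i = 1..k. (1 - x i * q ^ (2 * n + 1)) * (1 - q ^ (2 * n + 1) / x i)))" for n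
  define P where "P = qpoch [- a * q, - b * q] (q ^ 2) \<infinity> / qpoch [q ^ 2, a * b * q ^ 2] (q ^ 2) \<infinity>"
  have F: "F = (\<lambda>n. row_coeff q x j n * side_weight q a b n
        / (qfac (- a * q) (q\<^sup>2) (n + 1) * qfac (- b * q) (q\<^sup>2) (n + 1)))"
  proof
    fix n
    \<comment> \<open>The factor \<open>q ^ (2 * n + 1)\<close> belongs to
      \<open>side_weight\<close>, the other one to \<open>row_coeff\<close>.\<close>
    have "q ^ (n ^ 2 + (2 * k + 1) * n + k) = q ^ (n\<^sup>2 + (2 * j + 1) * n + j) * q ^ (2 * n + 1)"
      unfolding power_add[symmetric] k(1) by (simp add: algebra_simps)
    moreover have "(- a * b) ^ n = (- 1) ^ n * (a * b) ^ n"
      by (simp flip: power_mult_distrib)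
    ultimately show "F n = row_coeff q x j n * side_weight q a b n
        / (qfac (- a * q) (q\<^sup>2) (n + 1) * qfac (- b * q) (q\<^sup>2) (n + 1))"
      unfolding F_def fin row_coeff_def side_weight_eq_qfac[OF assms(3,4)] rank_factor_def k(2)
      by (simp only: times_divide_eq_left times_divide_eq_right divide_divide_eq_left mult_ac)
  qed
  have bailey: "summable F" "((\<lambda>t. side_weight q a b t * row_gf q x j t) has_sum (P * suminf F)) UNIV"
    unfolding F P_def inf
    by (rule bailey_transform[OF assms(2-4,6,7)]; rule x; assumption)+
  define W where "W = symbol_weight q a b x j"
  define D where "D = make_symbol ` symbol_data j"
  have W: "(W has_sum (P * suminf F)) D"
    unfolding W_def D_def by (rule has_sum_symbols[OF assms(2,6) _ bailey(2)]) (rule x)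
  \<comment> \<open>Each symbol has exactly one key of exponents, so \<open>D\<close> corresponds to
    the disjoint union of the fibers. The weight is constant on a fiber and the fiber has
    \<open>num_symbols\<close> elements, which turns the sum over symbols into the sum over
    exponents.\<close>
  define keys where "keys = ({1..k} \<rightarrow>\<^sub>E (UNIV :: int set)) \<times> (UNIV :: nat set) \<times> (UNIV :: nat set) \<times> (UNIV :: nat set)"
  define fiber where "fiber = (\<lambda>(m, r, s, n). {d. marked_gen_odd_durfee_symbol k d n \<and>
              card (missing (side d) (lam d)) = r \<and>
              card (missing (side d) (mu d)) = s \<and>
              (\<forall>i\<in>{1..k}. rank_at k d i = m i)})"
  define key where "key d = (restrict (rank_at k d) {1..k}, card (missing (side d) (lam d)),
      card (missing (side d) (mu d)), symbol_size d)" for d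
  have fiber_iff: "d \<in> fiber z \<longleftrightarrow> d \<in> D \<and> z = key d" if "z \<in> keys" for z d
  proof -
    obtain m r s n where z: "z = (m, r, s, n)" by (cases z)
    have "m \<in> {1..k} \<rightarrow>\<^sub>E UNIV"
      using that by (simp add: keys_def z)
    then have "(\<forall>i\<in>{1..k}. rank_at k d i = m i) \<longleftrightarrow> m = restrict (rank_at k d) {1..k}"
      by (auto simp: PiE_iff extensional_def fun_eq_iff)
    then show ?thesis
      using marked_symbol_iff[OF j] unfolding z fiber_def key_def D_def k(1) by auto
  qed
  have "bij_betw snd (Sigma keys fiber) D"
  proof (rule bij_betw_byWitness[where f' = "\<lambda>d. (key d, d)"])
    show "\<forall>z\<in>Sigma keys fiber. (key (snd z), snd z) = z" "snd ` Sigma keys fiber \<subseteq> D"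
      using fiber_iff by auto
    have key: "key d \<in> keys" for d
      by (simp add: key_def keys_def)
    show "(\<lambda>d. (key d, d)) ` D \<subseteq> Sigma keys fiber"
      using fiber_iff[OF key] key by blast
  qed simp
  then have sigma: "((\<lambda>z. W (snd z)) has_sum (P * suminf F)) (Sigma keys fiber)"
    using W by (simp add: has_sum_reindex_bij_betw)
  have "((\<lambda>(m, r, s, n). of_nat (num_symbols k r s m n)
         * (\<Prod>i = 1..k. x i powi m i) * a ^ r * b ^ s * q ^ n) has_sum (P * suminf F)) keys"
  proof (rule has_sum_SigmaD[OF sigma])
    fix z assume "z \<in> keys"
    obtain m r s n where z: "z = (m, r, s, n)" by (cases z)
    have "finite (fiber z)"
      by (rule finite_subset[OF _ finite_marked_symbols[of k n]]) (auto simp: fiber_def z)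
    moreover have "W d = (\<Prod>i = 1..k. x i powi m i) * a ^ r * b ^ s * q ^ n" if "d \<in> fiber z" for d
      using that marked_symbol_iff[OF j] by (auto simp: W_def symbol_weight_def fiber_def z k)
    ultimately show "((\<lambda>d. W (snd (z, d))) has_sum (case z of (m, r, s, n) \<Rightarrow> of_nat (num_symbols k r s m n)
         * (\<Prod>i = 1..k. x i powi m i) * a ^ r * b ^ s * q ^ n)) (fiber z)"
      by (intro has_sum_finiteI) (simp_all add: z num_symbols_def fiber_def mult.assoc)
  qed
  then show ?thesis
    using bailey(1) unfolding Let_def F_def[symmetric] P_def[symmetric] keys_def[symmetric] by simp
qed

end
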